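(* Let $G$ be a word-hyperbolic group. Suppose $S,S'$ are two finite symmetric generating sets of $G$, and $L\subset S^*$, $L'\subset(S')^*$ are combings of $G$ with respect to $S$ and $S'$ respectively. Then a function $\phi:G\to\mathbb{Z}$ is combable with respect to $S,L$ if and only if it is combable with respect to $S',L'$; and $\phi$ is bicombable with respect to $S,L$ if and only if it is bicombable with respect to $S',L'$.
   Context: $S^*$ is the set of finite words in $S$; for $w\in S^*$, $|w|$ is its length and $\overline{w}\in G$ its evaluation. A finite digraph $\Gamma$ with initial vertex $v_1$, whose edges are labeled by letters of $S$ with at most one outgoing edge with any given label at each vertex, parameterizes a prefix-closed language $L\subset S^*$ if $L$ is exactly the set of words read along directed paths starting at $v_1$; a prefix-closed language is regular iff it is parameterized by some such $\Gamma$. A combing of $G$ with respect to $S$ is a prefix-closed regular language $L\subset S^*$ such that evaluation $L\to G$ is a bijection and every $w\in L$ is geodesic (its length is the word length of $\overline{w}$ with respect to $S$). $\phi:G\to\mathbb{Z}$ is weakly combable with respect to $S,L$ if there are a digraph $\Gamma$ parameterizing $L$ and a function $d\phi$ from its vertices to $\mathbb{Z}$ with $\phi(\overline{w})=\sum_{i=0}^{|w|}d\phi(\gamma(i))$ for all $w\in L$, where $\gamma$ is the path in $\Gamma$ starting at $v_1$ corresponding to $w$ and $\gamma(i)$ is the vertex reached after $i$ edges ($\gamma(0)=v_1$). It is combable with respect to $S,L$ if it is weakly combable and there is $C$ with $|\phi(as)-\phi(a)|\le C$ for all $a\in G,s\in S$ (i.e. Lipschitz in the left-invariant word metric); it is bicombable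 if it is combable and there is also $C'$ with $|\phi(sa)-\phi(a)|\le C'$ for all $a\in G,s\in S$ (i.e. Lipschitz in the right-invariant word metric). *)

theory Defs
  imports "HOL-Algebra.Generated_Groups" "HOL-Library.Sublist"
begin

section \<open>Words and the word metric\<close>

definition sym_gen_set :: "('a, 'b) monoid_scheme \<Rightarrow> 'a set \<Rightarrow> bool" where
  "sym_gen_set G S \<longleftrightarrow>
     finite S \<and> S \<subseteq> carrier G \<and> (\<forall>s\<in>S. inv\<^bsub>G\<^esub> s \<in> S) \<and> generate G S = carrier G"

text \<open>A letter is an element of \<open>S\<close>, so the finite words in \<open>S\<close> form the set \<open>lists S\<close>.\<close>

definition word_eval :: "('a, 'b) monoid_scheme \<Rightarrow> 'a list \<Rightarrow> 'a" where
  "word_eval G w = foldr (\<lambda>x y. x \<otimes>\<^bsub>G\<^esub> y) w \<one>\<^bsub>G\<^esub>"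

definition word_length :: "('a, 'b) monoid_scheme \<Rightarrow> 'a set \<Rightarrow> 'a \<Rightarrow> nat" where
  "word_length G S g = (LEAST n. \<exists>w\<in>lists S. length w = n \<and> word_eval G w = g)"

definition word_dist :: "('a, 'b) monoid_scheme \<Rightarrow> 'a set \<Rightarrow> 'a \<Rightarrow> 'a \<Rightarrow> nat" where
  "word_dist G S a b = word_length G S (inv\<^bsub>G\<^esub> a \<otimes>\<^bsub>G\<^esub> b)"


section \<open>Word-hyperbolic groups\<close>

definition geodesic_path ::
  "('a, 'b) monoid_scheme \<Rightarrow> 'a set \<Rightarrow> (nat \<Rightarrow> 'a) \<Rightarrow> nat \<Rightarrow> 'a \<Rightarrow> 'a \<Rightarrow> bool" where
  "geodesic_path G S \<alpha> n a b \<longleftrightarrow>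
     \<alpha> 0 = a \<and> \<alpha> n = b \<and> (\<forall>i\<le>n. \<alpha> i \<in> carrier G) \<and>
     (\<forall>i j. i \<le> j \<longrightarrow> j \<le> n \<longrightarrow> word_dist G S (\<alpha> i) (\<alpha> j) = j - i)"

text \<open>
  Geodesic triangles in the Cayley graph are taken with corners at group elements, with sides
  recorded by the vertices they pass through. This differs from slimness of the geodesic triangles
  in the geometric realization only in the value of \<open>\<delta>\<close>. It is enough to bound the first side,
  because the condition ranges over all triangles, hence also over the two rotated ones.
\<close>

definition slim_triangles :: "('a, 'b) monoid_scheme \<Rightarrow> 'a set \<Rightarrow> nat \<Rightarrow> bool" where
  "slim_triangles G S \<delta> \<longleftrightarrow>
     (\<forall>a b c \<alpha> \<beta> \<gamma> l m n.
        geodesic_path G S \<alpha> l a b \<longrightarrow> geodesic_path G S \<beta> m b c \<longrightarrow> geodesic_path G S \<gamma> n c a \<longrightarrow>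
        (\<forall>i\<le>l. (\<exists>j\<le>m. word_dist G S (\<alpha> i) (\<beta> j) \<le> \<delta>) \<or>
                (\<exists>k\<le>n. word_dist G S (\<alpha> i) (\<gamma> k) \<le> \<delta>)))"

definition hyperbolic_group :: "('a, 'b) monoid_scheme \<Rightarrow> bool" where
  "hyperbolic_group G \<longleftrightarrow> group G \<and> (\<exists>S \<delta>. sym_gen_set G S \<and> slim_triangles G S \<delta>)"


section \<open>Labeled digraphs and combings\<close>

text \<open>
  Vertices are natural numbers; every finite digraph is isomorphic to one of this form. An edge
  \<open>(u, s, v)\<close> goes from \<open>u\<close> to \<open>v\<close> and carries the label \<open>s\<close>.
\<close>

record 'a labeled_digraph =
  verts :: "nat set"
  edges :: "(nat \<times> 'a \<times> nat) set"
  init :: nat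

definition labeled_digraph_over :: "'a set \<Rightarrow> 'a labeled_digraph \<Rightarrow> bool" where
  "labeled_digraph_over S \<Gamma> \<longleftrightarrow>
     finite (verts \<Gamma>) \<and> init \<Gamma> \<in> verts \<Gamma> \<and> edges \<Gamma> \<subseteq> verts \<Gamma> \<times> S \<times> verts \<Gamma> \<and>
     (\<forall>u s v v'. (u, s, v) \<in> edges \<Gamma> \<longrightarrow> (u, s, v') \<in> edges \<Gamma> \<longrightarrow> v = v')"

text \<open>
  \<open>\<gamma> i\<close> is the vertex reached after \<open>i\<close> edges; only the values for \<open>i \<le> length w\<close> matter, and on a
  graph satisfying \<open>labeled_digraph_over\<close> the word \<open>w\<close> determines these.
\<close>

definition path_for :: "'a labeled_digraph \<Rightarrow> 'a list \<Rightarrow> (nat \<Rightarrow> nat) \<Rightarrow> bool" where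
  "path_for \<Gamma> w \<gamma> \<longleftrightarrow>
     \<gamma> 0 = init \<Gamma> \<and> (\<forall>i<length w. (\<gamma> i, w ! i, \<gamma> (Suc i)) \<in> edges \<Gamma>)"

definition parameterizes :: "'a set \<Rightarrow> 'a labeled_digraph \<Rightarrow> 'a list set \<Rightarrow> bool" where
  "parameterizes S \<Gamma> L \<longleftrightarrow> labeled_digraph_over S \<Gamma> \<and> L = {w. \<exists>\<gamma>. path_for \<Gamma> w \<gamma>}"

definition prefix_closed :: "'a list set \<Rightarrow> bool" where
  "prefix_closed L \<longleftrightarrow> (\<forall>w\<in>L. \<forall>u. prefix u w \<longrightarrow> u \<in> L)"

definition prefix_closed_regular :: "'a set \<Rightarrow> 'a list set \<Rightarrow> bool" where
  "prefix_closed_regular S L \<longleftrightarrow>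
     L \<subseteq> lists S \<and> prefix_closed L \<and> (\<exists>\<Gamma>. parameterizes S \<Gamma> L)"

definition combing :: "('a, 'b) monoid_scheme \<Rightarrow> 'a set \<Rightarrow> 'a list set \<Rightarrow> bool" where
  "combing G S L \<longleftrightarrow>
     prefix_closed_regular S L \<and>
     bij_betw (word_eval G) L (carrier G) \<and>
     (\<forall>w\<in>L. length w = word_length G S (word_eval G w))"


section \<open>Combable functions\<close>

definition weakly_combable ::
  "('a, 'b) monoid_scheme \<Rightarrow> 'a set \<Rightarrow> 'a list set \<Rightarrow> ('a \<Rightarrow> int) \<Rightarrow> bool" where
  "weakly_combable G S L \<phi> \<longleftrightarrow>
     (\<exists>\<Gamma> d\<phi> :: nat \<Rightarrow> int. parameterizes S \<Gamma> L \<and>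
        (\<forall>w\<in>L. \<forall>\<gamma>. path_for \<Gamma> w \<gamma> \<longrightarrow> \<phi> (word_eval G w) = (\<Sum>i=0..length w. d\<phi> (\<gamma> i))))"

definition combable ::
  "('a, 'b) monoid_scheme \<Rightarrow> 'a set \<Rightarrow> 'a list set \<Rightarrow> ('a \<Rightarrow> int) \<Rightarrow> bool" where
  "combable G S L \<phi> \<longleftrightarrow>
     weakly_combable G S L \<phi> \<and>
     (\<exists>C. \<forall>a\<in>carrier G. \<forall>s\<in>S. \<bar>\<phi> (a \<otimes>\<^bsub>G\<^esub> s) - \<phi> a\<bar> \<le> C)"

definition bicombable ::
  "('a, 'b) monoid_scheme \<Rightarrow> 'a set \<Rightarrow> 'a list set \<Rightarrow> ('a \<Rightarrow> int) \<Rightarrow> bool" where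
  "bicombable G S L \<phi> \<longleftrightarrow>
     combable G S L \<phi> \<and>
     (\<exists>C'. \<forall>a\<in>carrier G. \<forall>s\<in>S. \<bar>\<phi> (s \<otimes>\<^bsub>G\<^esub> a) - \<phi> a\<bar> \<le> C')"

end

theory Submission
  imports Defs
begin

text \<open>
  Fix a slim word metric on \<open>G\<close>. Words of \<open>L\<close> and \<open>L'\<close> are geodesic for \<open>S\<close> and \<open>S'\<close>, hence
  quasi-geodesic for the fixed metric, so by the Morse lemma the words \<open>u \<in> L'\<close> and \<open>w \<in> L\<close> with
  the same endpoint fellow travel, after a monotone reparametrization, at distance at most a uniform
  \<open>K\<close>. While an automaton reads \<open>u\<close> it can therefore keep track of all \<open>w\<close> that fellow travel
  \<open>u\<close>: for each of them it stores the position of the endpoint of \<open>w\<close> in the \<open>K\<close>-ball around that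
  of \<open>u\<close>, the state of \<open>w\<close> in the digraph of \<open>L\<close>, and the difference of the values of \<open>\<phi>\<close> at
  the two endpoints. The last is bounded because \<open>\<phi>\<close> is Lipschitz, so finitely many states suffice,
  and they determine the increments of \<open>\<phi>\<close> along words of \<open>L'\<close>.
\<close>

section \<open>Quasi-geodesics in slim spaces\<close>

text \<open>An abstract copy of \<open>geodesic_path\<close> for an integer-valued distance on a
  set, so that the Morse lemma can be proved without mentioning a group.\<close>

definition is_geodesic :: "'a set \<Rightarrow> ('a \<Rightarrow> 'a \<Rightarrow> nat) \<Rightarrow> (nat \<Rightarrow> 'a) \<Rightarrow> nat \<Rightarrow> 'a \<Rightarrow> 'a \<Rightarrow> bool" where
  "is_geodesic X d \<alpha> n a b \<longleftrightarrow> \<alpha> 0 = a \<and> \<alpha> n = b \<and> (\<forall>i\<le>n. \<alpha> i \<in> X) \<and>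
     (\<forall>i j. i \<le> j \<longrightarrow> j \<le> n \<longrightarrow> d (\<alpha> i) (\<alpha> j) = j - i)"

text \<open>One constant plays all roles and the lower bound has no additive term; geodesic words
  for another generating set have this form. The upper bound is imposed on consecutive points only,
  and the triangle inequality extends it.\<close>

definition quasi_geodesic :: "'a set \<Rightarrow> ('a \<Rightarrow> 'a \<Rightarrow> nat) \<Rightarrow> nat \<Rightarrow> (nat \<Rightarrow> 'a) \<Rightarrow> nat \<Rightarrow> bool" where
  "quasi_geodesic X d \<kappa> p n \<longleftrightarrow> (\<forall>i\<le>n. p i \<in> X) \<and> (\<forall>i<n. d (p i) (p (Suc i)) \<le> \<kappa>) \<and>
     (\<forall>i j. i \<le> j \<longrightarrow> j \<le> n \<longrightarrow> j - i \<le> \<kappa> * d (p i) (p j))"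

text \<open>Powers of this relation stand for chains of jumps of size at most
  \<open>\<kappa>\<close> that stay in \<open>Y\<close>; concatenating and reversing chains becomes
  the algebra of relations.\<close>

definition near_rel :: "('a \<Rightarrow> 'a \<Rightarrow> nat) \<Rightarrow> nat \<Rightarrow> 'a set \<Rightarrow> ('a \<times> 'a) set" where
  "near_rel d \<kappa> Y = {(g, h). g \<in> Y \<and> h \<in> Y \<and> d g h \<le> \<kappa>}"

section \<open>Chains of bounded jumps\<close>

lemma sym_relpow: "sym R \<Longrightarrow> sym (R ^^ n)" for R :: "('a \<times> 'a) set"
proof (induction n)
  case 0
  then show ?case by (auto simp: sym_def)
next
  case (Suc n)
  then show ?case
    by (meson relpow_Suc_E relpow_Suc_I2 symE symI)
qed

lemma near_rel_relpow_in: "x \<in> Y \<Longrightarrow> (x, y) \<in> near_rel d \<kappa> Y ^^ n \<Longrightarrow> y \<in> Y"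
  by (cases n) (auto simp: near_rel_def)

lemma near_rel_path:
  assumes "\<And>i. i \<le> n \<Longrightarrow> f i \<in> Y" "\<And>i. i < n \<Longrightarrow> d (f i) (f (Suc i)) \<le> \<kappa>" "i \<le> j" "j \<le> n"
  shows "(f i, f j) \<in> near_rel d \<kappa> Y ^^ (j - i)"
  using assms(3,4)
proof (induction j rule: dec_induct)
  case base
  then show ?case by simp
next
  case (step m)
  have "(f m, f (Suc m)) \<in> near_rel d \<kappa> Y"
    using assms(1)[of m] assms(1)[of "Suc m"] assms(2)[of m] step by (auto simp: near_rel_def)
  then show ?case using step by (auto simp: Suc_diff_le)
qed

section \<open>Two facts about natural numbers\<close>

text \<open>Source of the contradiction in the Morse lemma: a detour around a ball of radius
  \<open>D\<close> takes at most \<open>A * D\<close> steps, hence at most \<open>2 ^ k\<close>,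
  while \<open>k\<close> halvings of it reach only a distance below \<open>D\<close>. The exponent
  is proportional to \<open>D\<close>, and the estimate of a square by a power of two does the
  rest.\<close>

lemma exp_dominates_linear:
  fixes A \<delta> \<kappa> :: nat
  shows "\<exists>D0. \<forall>D>D0. \<exists>k. A * D \<le> 2 ^ k \<and> \<delta> * k + \<kappa> < D"
proof -
  define B where "B = 2 * (\<delta> + 1)"
  have sq: "m * m \<le> 4 * 2 ^ m" for m :: nat
  proof (induction m rule: less_induct)
    case (less m)
    show ?case
    proof (cases "m < 4")
      case True
      then have "m = 0 \<or> m = 1 \<or> m = 2 \<or> m = 3" by auto
      then show ?thesis by auto
    next
      case False
      then obtain l where l: "m = Suc l" "l \<ge> 3" by (cases m) auto
      have "3 * l \<le> l * l" using l(2) by simp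
      moreover have "m * m = l * l + 2 * l + 1" using l by simp
      ultimately have "m * m \<le> 2 * (l * l)" using l(2) by linarith
      also have "\<dots> \<le> 2 * (4 * 2 ^ l)" using less[of l] l by simp
      finally show ?thesis using l by simp
    qed
  qed
  \<comment> \<open>The first summand of the threshold keeps \<open>\<kappa>\<close> below
    \<open>D / 2\<close>, the other half of \<open>D\<close> being left for
    \<open>\<delta> * k\<close>; the second forces \<open>k\<close> to be at least
    \<open>16 * A * B\<close>, so that \<open>k * k\<close> absorbs the linear term.\<close>
  have "\<exists>k. A * D \<le> 2 ^ k \<and> \<delta> * k + \<kappa> < D" if D: "D > 2 * \<kappa> + B * (16 * A * B)" for D
  proof -
    define k where "k = D div B"
    have B0: "B > 0" by (simp add: B_def)
    have 1: "B * k \<le> D" by (simp add: k_def)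
    have 2: "D < B * (k + 1)"
      using dividend_less_times_div[OF B0, of D] by (simp add: k_def algebra_simps)
    have "B * (16 * A * B) < B * (k + 1)" using D 2 by linarith
    then have 3: "16 * A * B \<le> k" using B0 by (metis Suc_eq_plus1 less_Suc_eq_le nat_mult_less_cancel1)
    have "A * D \<le> 2 ^ k"
    proof (cases "k = 0")
      case True
      then have "A = 0" using 3 B0 by simp
      then show ?thesis by simp
    next
      case False
      have "8 * (A * D) \<le> 8 * (A * (B * (k + 1)))" using 2 by simp
      also have "\<dots> \<le> 8 * (A * (B * (2 * k)))" using False by (intro mult_le_mono) auto
      also have "\<dots> = 16 * A * B * k" by (simp add: algebra_simps)
      also have "\<dots> \<le> k * k" using 3 by (rule mult_le_mono1)
      also have "\<dots> \<le> 4 * 2 ^ k" by (rule sq)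
      finally show ?thesis by simp
    qed
    moreover have "2 * (\<delta> * k) \<le> B * k" by (simp add: B_def)
    then have "\<delta> * k + \<kappa> < D" using 1 D by linarith
    ultimately show ?thesis by blast
  qed
  then show ?thesis by blast
qed

text \<open>If the level \<open>c\<close> is already attained one index before the end, recurse;
  otherwise the final jump starts below \<open>c\<close> and overshoots it by at most
  \<open>s\<close>. Downward jumps may be arbitrarily large.\<close>

lemma bounded_jump_intermediate_value:
  fixes f :: "nat \<Rightarrow> nat"
  assumes "f a \<le> c" "c \<le> f b" "a \<le> b" "\<And>t. a \<le> t \<Longrightarrow> t < b \<Longrightarrow> f (Suc t) \<le> f t + s"
  shows "\<exists>t. a \<le> t \<and> t \<le> b \<and> c \<le> f t \<and> f t \<le> c + s"
  using assms(3,2,4)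
proof (induction b rule: dec_induct)
  case base
  then show ?case using assms(1) by (intro exI[of _ a]) auto
next
  case (step n)
  show ?case
  proof (cases "c \<le> f n")
    case True
    then show ?thesis using step by (meson le_Suc_eq less_Suc_eq)
  next
    case False
    then have "f (Suc n) \<le> c + s" using step.prems(2)[of n] step.hyps by linarith
    then show ?thesis using step by (intro exI[of _ "Suc n"]) auto
  qed
qed

section \<open>Slim spaces and the distance from a geodesic to a chain\<close>

locale slim_geodesic_space =
  fixes X :: "'a set" and d :: "'a \<Rightarrow> 'a \<Rightarrow> nat" and \<delta> :: nat
  assumes dist_self: "x \<in> X \<Longrightarrow> d x x = 0"
    and dist_sym: "x \<in> X \<Longrightarrow> y \<in> X \<Longrightarrow> d x y = d y x"
    and dist_triangle: "x \<in> X \<Longrightarrow> y \<in> X \<Longrightarrow> z \<in> X \<Longrightarrow> d x z \<le> d x y + d y z"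
    and geodesic_ex: "x \<in> X \<Longrightarrow> y \<in> X \<Longrightarrow> \<exists>\<alpha> n. is_geodesic X d \<alpha> n x y"
    and slim: "is_geodesic X d \<alpha> l a b \<Longrightarrow> is_geodesic X d \<beta> m b c \<Longrightarrow> is_geodesic X d \<gamma> n c a \<Longrightarrow> i \<le> l \<Longrightarrow>
        (\<exists>j\<le>m. d (\<alpha> i) (\<beta> j) \<le> \<delta>) \<or> (\<exists>k\<le>n. d (\<alpha> i) (\<gamma> k) \<le> \<delta>)"
begin

lemma sym_near_rel: "Y \<subseteq> X \<Longrightarrow> sym (near_rel d \<kappa> Y)"
  using dist_sym by (fastforce simp: near_rel_def sym_def)

lemma is_geodesic_length: "is_geodesic X d \<alpha> n x y \<Longrightarrow> d x y = n"
  by (auto simp: is_geodesic_def)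

lemma is_geodesic_in: "is_geodesic X d \<alpha> n x y \<Longrightarrow> i \<le> n \<Longrightarrow> \<alpha> i \<in> X"
  by (auto simp: is_geodesic_def)

lemma is_geodesic_dist:
  "is_geodesic X d \<alpha> n x y \<Longrightarrow> i \<le> j \<Longrightarrow> j \<le> n \<Longrightarrow> d (\<alpha> i) (\<alpha> j) = j - i"
  by (auto simp: is_geodesic_def)

lemma quasi_geodesic_in: "quasi_geodesic X d \<kappa> p n \<Longrightarrow> i \<le> n \<Longrightarrow> p i \<in> X"
  by (auto simp: quasi_geodesic_def)

lemma quasi_geodesic_lower:
  "quasi_geodesic X d \<kappa> p n \<Longrightarrow> i \<le> j \<Longrightarrow> j \<le> n \<Longrightarrow> j - i \<le> \<kappa> * d (p i) (p j)"
  by (auto simp: quasi_geodesic_def)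

lemma quasi_geodesic_upper:
  assumes "quasi_geodesic X d \<kappa> p n" "i \<le> j" "j \<le> n"
  shows "d (p i) (p j) \<le> \<kappa> * (j - i)"
  using assms(2,3)
proof (induction j rule: dec_induct)
  case base
  then show ?case using dist_self quasi_geodesic_in[OF assms(1)] by simp
next
  case (step m)
  have "d (p i) (p (Suc m)) \<le> d (p i) (p m) + d (p m) (p (Suc m))"
    using step by (intro dist_triangle quasi_geodesic_in[OF assms(1)]) auto
  moreover have "d (p m) (p (Suc m)) \<le> \<kappa>" using assms(1) step by (auto simp: quasi_geodesic_def)
  moreover have "d (p i) (p m) \<le> \<kappa> * (m - i)" using step by simp
  ultimately show ?case using step by (simp add: Suc_diff_le)
qed

text \<open>Halving the chain \<open>k\<close> times costs one slim triangle each time, so only the logarithm of its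
  length matters.\<close>

lemma geodesic_near_chain:
  assumes "Y \<subseteq> X" "x \<in> Y" "(x, y) \<in> near_rel d \<kappa> Y ^^ N" "N \<le> 2 ^ k"
    "is_geodesic X d \<alpha> n x y" "i \<le> n"
  shows "\<exists>g\<in>Y. d (\<alpha> i) g \<le> \<delta> * k + \<kappa>"
  using assms(2-)
proof (induction k arbitrary: x y N \<alpha> n i)
  case 0
  have "N = 0 \<or> N = 1" using 0 by auto
  then have "d x y \<le> \<kappa>" using 0 assms(1) by (auto simp: near_rel_def dist_self)
  then have "d x (\<alpha> i) \<le> \<kappa>"
    using is_geodesic_length[OF 0(4)] 0(4,5) is_geodesic_dist[OF 0(4), of 0 i] by (auto simp: is_geodesic_def)
  moreover have "d x (\<alpha> i) = d (\<alpha> i) x" using 0 assms(1) is_geodesic_in by (intro dist_sym) auto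
  ultimately show ?case using 0 by auto
next
  case (Suc k)
  \<comment> \<open>Cut the chain so that each of the two pieces has at most \<open>2 ^ k\<close>
    steps.\<close>
  define N1 where "N1 = min N (2 ^ k)"
  define N2 where "N2 = N - N1"
  have N: "N = N1 + N2" "N1 \<le> 2 ^ k" "N2 \<le> 2 ^ k" using Suc.prems(3) by (auto simp: N1_def N2_def)
  obtain z where z: "(x, z) \<in> near_rel d \<kappa> Y ^^ N1" "(z, y) \<in> near_rel d \<kappa> Y ^^ N2"
    using Suc.prems(2) unfolding N(1) relpow_add by blast
  have Y: "z \<in> Y" "y \<in> Y"
    using near_rel_relpow_in[OF _ z(1)] near_rel_relpow_in[OF _ Suc.prems(2)] Suc.prems(1) by auto
  \<comment> \<open>The other two sides of the triangle run from \<open>y\<close> to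
    \<open>z\<close> and from \<open>z\<close> to \<open>x\<close>, so both half chains have to be
    read backwards.\<close>
  have rev: "(z, x) \<in> near_rel d \<kappa> Y ^^ N1" "(y, z) \<in> near_rel d \<kappa> Y ^^ N2"
    using z sym_relpow[OF sym_near_rel[OF assms(1)]] by (meson symE)+
  obtain \<beta> m where \<beta>: "is_geodesic X d \<beta> m y z" using geodesic_ex Y assms(1) by blast
  obtain \<gamma> l where \<gamma>: "is_geodesic X d \<gamma> l z x" using geodesic_ex Y assms(1) Suc.prems(1) by blast
  have \<alpha>i: "\<alpha> i \<in> X" using Suc.prems is_geodesic_in by blast
  have *: "\<exists>h\<in>Y. d (\<alpha> i) h \<le> \<delta> * Suc k + \<kappa>"
    if "d (\<alpha> i) g \<le> \<delta>" "g \<in> X" "\<exists>h\<in>Y. d g h \<le> \<delta> * k + \<kappa>" for g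
  proof -
    from that(3) obtain h where h: "h \<in> Y" "d g h \<le> \<delta> * k + \<kappa>" by blast
    then have "d (\<alpha> i) h \<le> d (\<alpha> i) g + d g h" using assms(1) that \<alpha>i by (intro dist_triangle) auto
    then show ?thesis using h that by (intro bexI[of _ h]) auto
  qed
  from slim[OF Suc.prems(4) \<beta> \<gamma> Suc.prems(5)] show ?case
  proof
    assume "\<exists>j\<le>m. d (\<alpha> i) (\<beta> j) \<le> \<delta>"
    then obtain j where j: "j \<le> m" "d (\<alpha> i) (\<beta> j) \<le> \<delta>" by blast
    show ?thesis
      by (rule *[OF j(2) is_geodesic_in[OF \<beta> j(1)] Suc.IH[OF Y(2) rev(2) N(3) \<beta> j(1)]])
  next
    assume "\<exists>j\<le>l. d (\<alpha> i) (\<gamma> j) \<le> \<delta>"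
    then obtain j where j: "j \<le> l" "d (\<alpha> i) (\<gamma> j) \<le> \<delta>" by blast
    show ?thesis
      by (rule *[OF j(2) is_geodesic_in[OF \<gamma> j(1)] Suc.IH[OF Y(1) rev(1) N(2) \<gamma> j(1)]])
  qed
qed

lemma is_geodesic_sub:
  assumes "is_geodesic X d \<alpha> n x y" "s \<le> t" "t \<le> n"
  shows "is_geodesic X d (\<lambda>i. \<alpha> (s + i)) (t - s) (\<alpha> s) (\<alpha> t)"
  using assms by (auto simp: is_geodesic_def)

section \<open>The Morse lemma\<close>

text \<open>Take the point \<open>\<alpha> t0\<close> of the geodesic that is farthest from the
  path, at distance \<open>D\<close>. Leaving the geodesic about \<open>2 * D\<close> before it,
  following the path and returning about \<open>2 * D\<close> after it gives a chain that avoids the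
  open \<open>D\<close>-ball around \<open>\<alpha> t0\<close>. Its length is linear in
  \<open>D\<close>, but \<open>geodesic_near_chain\<close> puts it within a logarithmic distance of
  \<open>\<alpha> t0\<close>, so \<open>D\<close> is bounded.\<close>

lemma geodesic_near_quasi_geodesic:
  assumes "\<kappa> \<ge> 1"
  shows "\<exists>D0. \<forall>p n \<alpha> m t. quasi_geodesic X d \<kappa> p n \<longrightarrow> is_geodesic X d \<alpha> m (p 0) (p n) \<longrightarrow> t \<le> m \<longrightarrow>
    (\<exists>i\<le>n. d (\<alpha> t) (p i) \<le> D0)"
proof -
  \<comment> \<open>The detour consists of two arms of at most \<open>D\<close> steps each and a
    piece of the path of at most \<open>6 * \<kappa> * D\<close> steps.\<close>
  obtain D0 where D0: "\<And>D. D > D0 \<Longrightarrow> \<exists>k. (2 + 6 * \<kappa>) * D \<le> 2 ^ k \<and> \<delta> * k + \<kappa> < D"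
    using exp_dominates_linear by metis
  have "\<exists>i\<le>n. d (\<alpha> t) (p i) \<le> D0"
    if p: "quasi_geodesic X d \<kappa> p n" and \<alpha>: "is_geodesic X d \<alpha> m (p 0) (p n)" and t: "t \<le> m" for p n \<alpha> m t
  proof -
    define e where "e t = Min ((\<lambda>i. d (\<alpha> t) (p i)) ` {..n})" for t
    have e_le: "e t \<le> d (\<alpha> t) (p i)" if "i \<le> n" for t i using that by (auto simp: e_def)
    have e_ex: "\<exists>i\<le>n. d (\<alpha> t) (p i) = e t" for t
    proof -
      have "e t \<in> (\<lambda>i. d (\<alpha> t) (p i)) ` {..n}" unfolding e_def by (rule Min_in) auto
      then show ?thesis by auto
    qed
    define D where "D = Max (e ` {..m})"
    have "D \<in> e ` {..m}" unfolding D_def by (rule Max_in) auto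
    then obtain t0 where t0: "t0 \<le> m" "e t0 = D" by auto
    have D: "e s \<le> D" if "s \<le> m" for s using that by (auto simp: D_def)
    have pX: "p i \<in> X" if "i \<le> n" for i using quasi_geodesic_in[OF p that] .
    have \<alpha>X: "\<alpha> i \<in> X" if "i \<le> m" for i using is_geodesic_in[OF \<alpha> that] .
    have ends: "p 0 = \<alpha> 0" "p n = \<alpha> m" using \<alpha> by (auto simp: is_geodesic_def)
    have "D \<le> D0"
    proof (rule ccontr)
      assume "\<not> D \<le> D0"
      then obtain k where k: "(2 + 6 * \<kappa>) * D \<le> 2 ^ k" "\<delta> * k + \<kappa> < D" using D0[of D] by auto
      \<comment> \<open>The complement of the open ball. It contains the whole path, since
        \<open>D\<close> is the least distance from \<open>\<alpha> t0\<close> to the path.\<close>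
      define Y where "Y = {g \<in> X. D \<le> d (\<alpha> t0) g}"
      let ?R = "near_rel d \<kappa> Y"
      have YX: "Y \<subseteq> X" by (auto simp: Y_def)
      have sym: "sym (?R ^^ j)" for j using sym_relpow[OF sym_near_rel[OF YX]] .
      have pY: "p i \<in> Y" if "i \<le> n" for i
        using that pX e_le[of i t0] t0 by (auto simp: Y_def)
      \<comment> \<open>An arm is a geodesic from \<open>\<alpha> s\<close> to a nearest point of
        the path. It starts at distance \<open>2 * D\<close> from \<open>\<alpha> t0\<close> and has
        length at most \<open>D\<close>, so it cannot enter the open ball.\<close>
      have arm: "\<exists>i a. i \<le> n \<and> a \<le> D \<and> d (\<alpha> s) (p i) \<le> D \<and> \<alpha> s \<in> Y \<and> (\<alpha> s, p i) \<in> ?R ^^ a"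
        if s: "s \<le> m" "d (\<alpha> t0) (\<alpha> s) = 2 * D" for s
      proof -
        obtain i where i: "i \<le> n" "d (\<alpha> s) (p i) = e s" using e_ex by blast
        obtain \<beta> a where \<beta>: "is_geodesic X d \<beta> a (\<alpha> s) (p i)"
          using geodesic_ex \<alpha>X pX s i by blast
        have a: "a \<le> D" using is_geodesic_length[OF \<beta>] i D s by auto
        have "\<beta> j \<in> Y" if "j \<le> a" for j
        proof -
          have X: "\<beta> j \<in> X" using is_geodesic_in[OF \<beta> that] .
          have "d (\<alpha> s) (\<beta> j) = j" using is_geodesic_dist[OF \<beta>, of 0 j] that \<beta> by (auto simp: is_geodesic_def)
          moreover have "d (\<alpha> t0) (\<alpha> s) \<le> d (\<alpha> t0) (\<beta> j) + d (\<beta> j) (\<alpha> s)"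
            using X \<alpha>X s t0 by (intro dist_triangle) auto
          moreover have "d (\<beta> j) (\<alpha> s) = d (\<alpha> s) (\<beta> j)" using X \<alpha>X s by (intro dist_sym) auto
          ultimately show ?thesis using X s a that by (auto simp: Y_def)
        qed
        note \<beta>Y = this
        have step: "d (\<beta> j) (\<beta> (Suc j)) \<le> \<kappa>" if "j < a" for j
          using is_geodesic_dist[OF \<beta>, of j "Suc j"] that assms by auto
        have "(\<beta> 0, \<beta> a) \<in> ?R ^^ (a - 0)" by (rule near_rel_path[where n = a]) (use \<beta>Y step in auto)
        then have "(\<alpha> s, p i) \<in> ?R ^^ a" using \<beta> by (auto simp: is_geodesic_def)
        moreover have "\<alpha> s \<in> Y" using \<beta>Y[of 0] \<beta> by (auto simp: is_geodesic_def)
        ultimately show ?thesis using i a D s by (intro exI[of _ i] exI[of _ a]) auto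
      qed
      \<comment> \<open>If fewer than \<open>2 * D\<close> steps precede \<open>t0\<close>, start at
        the common endpoint of geodesic and path instead, with an arm of length zero. The other side
        is treated in the same way.\<close>
      have "\<exists>s i a. s \<le> t0 \<and> t0 \<le> s + 2 * D \<and> i \<le> n \<and> a \<le> D \<and> d (\<alpha> s) (p i) \<le> D \<and> \<alpha> s \<in> Y \<and> (\<alpha> s, p i) \<in> ?R ^^ a"
      proof (cases "2 * D \<le> t0")
        case True
        have "d (\<alpha> (t0 - 2 * D)) (\<alpha> t0) = 2 * D"
          using is_geodesic_dist[OF \<alpha>, of "t0 - 2 * D" t0] True t0 by auto
        then have "d (\<alpha> t0) (\<alpha> (t0 - 2 * D)) = 2 * D"
          using dist_sym \<alpha>X t0 by auto
        moreover have "t0 - 2 * D \<le> m" using t0(1) by simp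
        ultimately obtain i a where "i \<le> n" "a \<le> D" "d (\<alpha> (t0 - 2 * D)) (p i) \<le> D"
          "\<alpha> (t0 - 2 * D) \<in> Y" "(\<alpha> (t0 - 2 * D), p i) \<in> ?R ^^ a" using arm by blast
        then show ?thesis by (intro exI[of _ "t0 - 2 * D"] exI[of _ i] exI[of _ a]) simp
      next
        case False
        then show ?thesis using pY[of 0] dist_self[OF pX[of 0]] ends
          by (intro exI[of _ 0] exI[of _ 0] exI[of _ "0::nat"]) auto
      qed
      then obtain s1 i1 a1 where 1: "s1 \<le> t0" "t0 \<le> s1 + 2 * D" "i1 \<le> n" "a1 \<le> D" "d (\<alpha> s1) (p i1) \<le> D"
        "\<alpha> s1 \<in> Y" "(\<alpha> s1, p i1) \<in> ?R ^^ a1" by blast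
      have "\<exists>s i a. s \<le> m \<and> t0 \<le> s \<and> s \<le> t0 + 2 * D \<and> i \<le> n \<and> a \<le> D \<and> d (\<alpha> s) (p i) \<le> D \<and> \<alpha> s \<in> Y \<and> (\<alpha> s, p i) \<in> ?R ^^ a"
      proof (cases "t0 + 2 * D \<le> m")
        case True
        have "d (\<alpha> t0) (\<alpha> (t0 + 2 * D)) = 2 * D"
          using is_geodesic_dist[OF \<alpha>, of t0 "t0 + 2 * D"] True by auto
        then obtain i a where "i \<le> n" "a \<le> D" "d (\<alpha> (t0 + 2 * D)) (p i) \<le> D"
          "\<alpha> (t0 + 2 * D) \<in> Y" "(\<alpha> (t0 + 2 * D), p i) \<in> ?R ^^ a" using arm True by blast
        then show ?thesis using True by (intro exI[of _ "t0 + 2 * D"] exI[of _ i] exI[of _ a]) simp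
      next
        case False
        then show ?thesis using pY[of n] dist_self[OF pX[of n]] ends t0
          by (intro exI[of _ m] exI[of _ n] exI[of _ "0::nat"]) auto
      qed
      then obtain s2 i2 a2 where 2: "s2 \<le> m" "t0 \<le> s2" "s2 \<le> t0 + 2 * D" "i2 \<le> n" "a2 \<le> D" "d (\<alpha> s2) (p i2) \<le> D"
        "\<alpha> s2 \<in> Y" "(\<alpha> s2, p i2) \<in> ?R ^^ a2" by blast
      have s12: "s1 \<le> s2" "s1 \<le> m" using 1 2 by auto
      have "d (p i1) (p i2) \<le> d (p i1) (\<alpha> s1) + d (\<alpha> s1) (p i2)"
        using 1 2 s12 pX \<alpha>X by (intro dist_triangle) auto
      also have "\<dots> \<le> d (p i1) (\<alpha> s1) + (d (\<alpha> s1) (\<alpha> s2) + d (\<alpha> s2) (p i2))"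
        using 1 2 s12 pX \<alpha>X by (intro add_left_mono dist_triangle) auto
      also have "\<dots> \<le> D + (4 * D + D)"
        using 1 2 s12 pX \<alpha>X is_geodesic_dist[OF \<alpha> s12(1) 2(1)] dist_sym[of "p i1" "\<alpha> s1"]
        by (intro add_mono) auto
      finally have p12: "d (p i1) (p i2) \<le> 6 * D" by simp
      \<comment> \<open>The lower bound for quasi-geodesics turns the distance \<open>6 * D\<close>
        into a number of steps. The two indices may come in either order, in which case the chain is
        reversed.\<close>
      have "\<exists>b\<le>6 * \<kappa> * D. (p i1, p i2) \<in> ?R ^^ b"
      proof -
        have q: "(p i, p j) \<in> ?R ^^ (j - i)" if "i \<le> j" "j \<le> n" for i j
          by (rule near_rel_path[where n = n]) (use pY p that in \<open>auto simp: quasi_geodesic_def\<close>)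
        show ?thesis
        proof (cases "i1 \<le> i2")
          case True
          have "i2 - i1 \<le> \<kappa> * d (p i1) (p i2)" using quasi_geodesic_lower[OF p True 2(4)] .
          also have "\<dots> \<le> \<kappa> * (6 * D)" using p12 by simp
          finally show ?thesis using q[OF True 2(4)] by (intro exI[of _ "i2 - i1"]) (auto simp: algebra_simps)
        next
          case False
          then have F: "i2 \<le> i1" by simp
          have "i1 - i2 \<le> \<kappa> * d (p i2) (p i1)" using quasi_geodesic_lower[OF p F 1(3)] .
          also have "\<dots> \<le> \<kappa> * (6 * D)" using p12 dist_sym pX 1 2 by simp
          finally show ?thesis using symD[OF sym q[OF F 1(3)]]
            by (intro exI[of _ "i1 - i2"]) (auto simp: algebra_simps)
        qed
      qed
      then obtain b where b: "b \<le> 6 * \<kappa> * D" "(p i1, p i2) \<in> ?R ^^ b" by blast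
      \<comment> \<open>Arm, path piece and reversed arm together; \<open>\<alpha> t0\<close> has
        index \<open>t0 - s1\<close> on the subgeodesic they bypass.\<close>
      have "(\<alpha> s1, \<alpha> s2) \<in> ?R ^^ (a1 + b + a2)"
        using 1(7) b(2) symD[OF sym 2(8)] unfolding relpow_add by blast
      moreover have "t0 - s1 \<le> s2 - s1" using 2(2) by simp
      moreover have "a1 + b + a2 \<le> 2 ^ k" using 1(4) 2(5) b(1) k(1) by (simp add: algebra_simps)
      ultimately obtain g where "g \<in> Y" "d (\<alpha> (s1 + (t0 - s1))) g \<le> \<delta> * k + \<kappa>"
        using geodesic_near_chain[OF YX 1(6) _ _ is_geodesic_sub[OF \<alpha> s12(1) 2(1)], where i = "t0 - s1"]
        by blast
      then show False using 1 k by (auto simp: Y_def)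
    qed
    then show ?thesis using e_ex[of t] D[OF t] by (metis le_trans)
  qed
  then show ?thesis by blast
qed

text \<open>Assign to each \<open>t\<close> the index of a point of the path near
  \<open>\<alpha> t\<close>. As \<open>t\<close> advances by one this index rises by a bounded
  amount, so every index \<open>i\<close> of the path is met up to a bounded error, and that error
  costs only a bounded distance along the path.\<close>

lemma quasi_geodesic_near_geodesic:
  assumes "\<kappa> \<ge> 1"
  shows "\<exists>D0. \<forall>p n \<alpha> m i. quasi_geodesic X d \<kappa> p n \<longrightarrow> is_geodesic X d \<alpha> m (p 0) (p n) \<longrightarrow> i \<le> n \<longrightarrow>
    (\<exists>t\<le>m. d (p i) (\<alpha> t) \<le> D0)"
proof -
  obtain D where D: "\<And>p n \<alpha> m t. quasi_geodesic X d \<kappa> p n \<Longrightarrow> is_geodesic X d \<alpha> m (p 0) (p n) \<Longrightarrow> t \<le> m \<Longrightarrow>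
    \<exists>i\<le>n. d (\<alpha> t) (p i) \<le> D" using geodesic_near_quasi_geodesic[OF assms] by metis
  have "\<exists>t\<le>m. d (p i) (\<alpha> t) \<le> \<kappa> * (\<kappa> * (2 * D + 1)) + D"
    if p: "quasi_geodesic X d \<kappa> p n" and \<alpha>: "is_geodesic X d \<alpha> m (p 0) (p n)" and i: "i \<le> n" for p n \<alpha> m i
  proof (cases "i = 0")
    case True
    then show ?thesis using \<alpha> dist_self[OF quasi_geodesic_in[OF p i]] by (auto simp: is_geodesic_def)
  next
    case i0: False
    have pX: "p i \<in> X" if "i \<le> n" for i using quasi_geodesic_in[OF p that] .
    have \<alpha>X: "\<alpha> i \<in> X" if "i \<le> m" for i using is_geodesic_in[OF \<alpha> that] .
    obtain h where h: "\<And>t. t \<le> m \<Longrightarrow> h t \<le> n \<and> d (\<alpha> t) (p (h t)) \<le> D" using D[OF p \<alpha>] by metis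
    \<comment> \<open>The end values are prescribed so that the index runs from \<open>0\<close> to
      \<open>n\<close>; they are admissible because geodesic and path share their endpoints. As
      \<open>i\<close> is positive, \<open>m\<close> is positive too and the two prescriptions do
      not clash.\<close>
    define f where "f t = (if t = 0 then 0 else if t = m then n else h t)" for t
    have m0: "m > 0"
    proof (rule ccontr)
      assume "\<not> m > 0"
      then have "p 0 = p n" using \<alpha> by (auto simp: is_geodesic_def)
      then show False using quasi_geodesic_lower[OF p, of 0 n] i i0 pX dist_self by auto
    qed
    have f: "f t \<le> n \<and> d (\<alpha> t) (p (f t)) \<le> D" if "t \<le> m" for t
      using h[OF that] \<alpha> dist_self[OF pX] by (auto simp: f_def is_geodesic_def)
    have jump: "f (Suc t) \<le> f t + \<kappa> * (2 * D + 1)" if "t < m" for t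
    proof (cases "f t \<le> f (Suc t)")
      case True
      have "f (Suc t) - f t \<le> \<kappa> * d (p (f t)) (p (f (Suc t)))"
        using quasi_geodesic_lower[OF p True] f that by auto
      also have "d (p (f t)) (p (f (Suc t))) \<le> d (p (f t)) (\<alpha> t) + d (\<alpha> t) (p (f (Suc t)))"
        using f[of t] f[of "Suc t"] that pX \<alpha>X by (intro dist_triangle) auto
      also have "\<dots> \<le> d (p (f t)) (\<alpha> t) + (d (\<alpha> t) (\<alpha> (Suc t)) + d (\<alpha> (Suc t)) (p (f (Suc t))))"
        using f[of t] f[of "Suc t"] that pX \<alpha>X by (intro add_left_mono dist_triangle) auto
      also have "\<dots> \<le> D + (1 + D)"
        using f[of t] f[of "Suc t"] that pX \<alpha>X is_geodesic_dist[OF \<alpha>, of t "Suc t"] dist_sym[of "p (f t)" "\<alpha> t"]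
        by (intro add_mono) auto
      finally show ?thesis by (simp add: algebra_simps)
    qed auto
    obtain t where t: "t \<le> m" "i \<le> f t" "f t \<le> i + \<kappa> * (2 * D + 1)"
      using bounded_jump_intermediate_value[of f 0 i m] jump i m0 by (auto simp: f_def)
    have "d (p i) (\<alpha> t) \<le> d (p i) (p (f t)) + d (p (f t)) (\<alpha> t)"
      using f[OF t(1)] t i pX \<alpha>X by (intro dist_triangle) auto
    also have "\<dots> \<le> \<kappa> * (f t - i) + D"
      using f[OF t(1)] t i pX \<alpha>X quasi_geodesic_upper[OF p t(2)] dist_sym[of "p (f t)" "\<alpha> t"] by (intro add_mono) auto
    also have "\<dots> \<le> \<kappa> * (\<kappa> * (2 * D + 1)) + D" using t by (intro add_right_mono mult_left_mono) auto
    finally show ?thesis using t by blast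
  qed
  then show ?thesis by blast
qed

text \<open>Both paths stay close to a common geodesic between their endpoints.\<close>

lemma quasi_geodesics_close:
  assumes "\<kappa> \<ge> 1"
  shows "\<exists>K. \<forall>p n q m i. quasi_geodesic X d \<kappa> p n \<longrightarrow> quasi_geodesic X d \<kappa> q m \<longrightarrow> p 0 = q 0 \<longrightarrow> p n = q m \<longrightarrow>
    i \<le> n \<longrightarrow> (\<exists>j\<le>m. d (p i) (q j) \<le> K)"
proof -
  obtain D where D: "\<And>p n \<alpha> m t. quasi_geodesic X d \<kappa> p n \<Longrightarrow> is_geodesic X d \<alpha> m (p 0) (p n) \<Longrightarrow> t \<le> m \<Longrightarrow>
    \<exists>i\<le>n. d (\<alpha> t) (p i) \<le> D" using geodesic_near_quasi_geodesic[OF assms] by metis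
  obtain E where E: "\<And>p n \<alpha> m i. quasi_geodesic X d \<kappa> p n \<Longrightarrow> is_geodesic X d \<alpha> m (p 0) (p n) \<Longrightarrow> i \<le> n \<Longrightarrow>
    \<exists>t\<le>m. d (p i) (\<alpha> t) \<le> E" using quasi_geodesic_near_geodesic[OF assms] by metis
  have "\<exists>j\<le>m. d (p i) (q j) \<le> E + D"
    if pq: "quasi_geodesic X d \<kappa> p n" "quasi_geodesic X d \<kappa> q m" "p 0 = q 0" "p n = q m" "i \<le> n" for p n q m i
  proof -
    obtain \<alpha> l where \<alpha>: "is_geodesic X d \<alpha> l (p 0) (p n)"
      using geodesic_ex pq quasi_geodesic_in by (metis le0 le_refl)
    obtain t where t: "t \<le> l" "d (p i) (\<alpha> t) \<le> E" using E[OF pq(1) \<alpha> pq(5)] by blast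
    obtain j where j: "j \<le> m" "d (\<alpha> t) (q j) \<le> D" using D[OF pq(2) _ t(1)] \<alpha> pq by metis
    have "d (p i) (q j) \<le> d (p i) (\<alpha> t) + d (\<alpha> t) (q j)"
      using pq t j \<alpha> is_geodesic_in quasi_geodesic_in by (intro dist_triangle) auto
    then show ?thesis using t j by (intro exI[of _ j]) auto
  qed
  then show ?thesis by blast
qed

section \<open>Monotone reparametrization\<close>

text \<open>Nearest indices \<open>j i\<close> need not be monotone, so they are replaced by their
  running maximum \<open>J i = j k\<close> with \<open>k \<le> i\<close>. After time
  \<open>i\<close> the index comes back near this level at some \<open>l\<close>; then
  \<open>p k\<close> and \<open>p l\<close> are close, hence \<open>k\<close> and \<open>l\<close>
  are close, and so is \<open>i\<close> between them.\<close>

lemma quasi_geodesics_fellow_travel: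
  assumes "\<kappa> \<ge> 1"
  shows "\<exists>K M. \<forall>p n q m. quasi_geodesic X d \<kappa> p n \<longrightarrow> quasi_geodesic X d \<kappa> q m \<longrightarrow> p 0 = q 0 \<longrightarrow> p n = q m \<longrightarrow>
    (\<exists>J. J 0 = 0 \<and> J n = m \<and> (\<forall>i<n. J i \<le> J (Suc i) \<and> J (Suc i) \<le> J i + M) \<and>
         (\<forall>i\<le>n. J i \<le> m \<and> d (p i) (q (J i)) \<le> K))"
proof -
  obtain K where K: "\<And>p n q m i. quasi_geodesic X d \<kappa> p n \<Longrightarrow> quasi_geodesic X d \<kappa> q m \<Longrightarrow> p 0 = q 0 \<Longrightarrow> p n = q m \<Longrightarrow>
    i \<le> n \<Longrightarrow> \<exists>j\<le>m. d (p i) (q j) \<le> K" using quasi_geodesics_close[OF assms] by metis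
  \<comment> \<open>Points of \<open>q\<close> matched with consecutive points of \<open>p\<close>
    are at distance at most \<open>2 * K + \<kappa>\<close>. In \<open>K'\<close> the inner bracket
    bounds the distance of \<open>p k\<close> and \<open>p l\<close>, one factor
    \<open>\<kappa>\<close> turns it into a bound on \<open>l - k\<close>, and the outer one turns
    that into a distance again.\<close>
  define M where "M = \<kappa> * (2 * K + \<kappa>)"
  define K' where "K' = \<kappa> * (\<kappa> * (2 * K + \<kappa> * M)) + K"
  have "\<exists>J. J 0 = 0 \<and> J n = m \<and> (\<forall>i<n. J i \<le> J (Suc i) \<and> J (Suc i) \<le> J i + M) \<and>
         (\<forall>i\<le>n. J i \<le> m \<and> d (p i) (q (J i)) \<le> K')"
    if p: "quasi_geodesic X d \<kappa> p n" and q: "quasi_geodesic X d \<kappa> q m" and ends: "p 0 = q 0" "p n = q m" for p n q m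
  proof -
    have pX: "p i \<in> X" if "i \<le> n" for i using quasi_geodesic_in[OF p that] .
    have qX: "q i \<in> X" if "i \<le> m" for i using quasi_geodesic_in[OF q that] .
    obtain h where h: "\<And>i. i \<le> n \<Longrightarrow> h i \<le> m \<and> d (p i) (q (h i)) \<le> K" using K[OF p q ends] by metis
    \<comment> \<open>Prescribed end values again. For \<open>n = 0\<close> the first clause
      applies, and \<open>j n = m\<close> holds because equal endpoints force
      \<open>m = 0\<close>.\<close>
    define j where "j i = (if i = 0 then 0 else if i = n then m else h i)" for i
    have jn: "j n = m"
    proof (cases "n = 0")
      case True
      then have "d (q 0) (q m) = 0" using ends dist_self qX by auto
      then have "m = 0" using quasi_geodesic_lower[OF q, of 0 m] by auto
      then show ?thesis by (simp add: j_def True)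
    qed (auto simp: j_def)
    have j: "j i \<le> m \<and> d (p i) (q (j i)) \<le> K" if "i \<le> n" for i
      using h[OF that] jn ends dist_self pX qX by (auto simp: j_def)
    have jump: "j (Suc i) \<le> j i + M" if "i < n" for i
    proof (cases "j i \<le> j (Suc i)")
      case True
      have "j (Suc i) - j i \<le> \<kappa> * d (q (j i)) (q (j (Suc i)))"
        using quasi_geodesic_lower[OF q True] j that by auto
      also have "d (q (j i)) (q (j (Suc i))) \<le> d (q (j i)) (p i) + d (p i) (q (j (Suc i)))"
        using j[of i] j[of "Suc i"] that pX qX by (intro dist_triangle) auto
      also have "\<dots> \<le> d (q (j i)) (p i) + (d (p i) (p (Suc i)) + d (p (Suc i)) (q (j (Suc i))))"
        using j[of i] j[of "Suc i"] that pX qX by (intro add_left_mono dist_triangle) auto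
      also have "\<dots> \<le> K + (\<kappa> + K)"
        using j[of i] j[of "Suc i"] that pX qX p dist_sym[of "q (j i)" "p i"]
        by (intro add_mono) (auto simp: quasi_geodesic_def)
      finally show ?thesis by (simp add: algebra_simps M_def)
    qed auto
    define J where "J i = Max (j ` {..i})" for i
    have Jge: "j k \<le> J i" if "k \<le> i" for k i using that by (auto simp: J_def)
    have Jex: "\<exists>k\<le>i. J i = j k" for i
    proof -
      have "J i \<in> j ` {..i}" unfolding J_def by (rule Max_in) auto
      then show ?thesis by auto
    qed
    have "J 0 = 0" by (simp add: J_def j_def)
    moreover have Jm: "J i \<le> m" if "i \<le> n" for i using Jex[of i] j that by auto
    moreover have "J n = m" using Jm[of n] Jge[of n n] jn by auto
    moreover have "J i \<le> J (Suc i)" for i unfolding J_def by (intro Max_mono) auto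
    moreover have "J (Suc i) \<le> J i + M" if "i < n" for i
    proof -
      obtain k where k: "k \<le> Suc i" "J (Suc i) = j k" using Jex by blast
      show ?thesis
      proof (cases "k = Suc i")
        case True
        then show ?thesis using k jump[OF that] Jge[of i i] by auto
      next
        case False
        then show ?thesis using k Jge[of k i] by auto
      qed
    qed
    moreover have "d (p i) (q (J i)) \<le> K'" if i: "i \<le> n" for i
    proof -
      obtain k where k: "k \<le> i" "J i = j k" using Jex by blast
      \<comment> \<open>Since \<open>j i \<le> J i = j k\<close> and \<open>j n = m\<close>, the
        level \<open>j k\<close> is reached again between \<open>i\<close> and
        \<open>n\<close>.\<close>
      obtain l where l: "i \<le> l" "l \<le> n" "j k \<le> j l" "j l \<le> j k + M"
        using bounded_jump_intermediate_value[of j i "j k" n M] jump i k Jge[of i i] jn j[of k] by auto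
      have "d (p k) (p l) \<le> d (p k) (q (j k)) + d (q (j k)) (p l)"
        using j[of k] j[of l] pX qX k l i by (intro dist_triangle) auto
      also have "\<dots> \<le> d (p k) (q (j k)) + (d (q (j k)) (q (j l)) + d (q (j l)) (p l))"
        using j[of k] j[of l] pX qX k l i by (intro add_left_mono dist_triangle) auto
      also have "\<dots> \<le> K + (\<kappa> * (j l - j k) + K)"
        using j[of k] j[of l] pX qX k l i quasi_geodesic_upper[OF q l(3)] dist_sym[of "q (j l)" "p l"]
        by (intro add_mono) auto
      also have "\<dots> \<le> K + (\<kappa> * M + K)" using l by (intro add_left_mono add_right_mono mult_left_mono) auto
      finally have kl: "d (p k) (p l) \<le> 2 * K + \<kappa> * M" by simp
      have "l - k \<le> \<kappa> * d (p k) (p l)" using quasi_geodesic_lower[OF p, of k l] k l by auto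
      also have "\<dots> \<le> \<kappa> * (2 * K + \<kappa> * M)" using kl by simp
      finally have ik: "i - k \<le> \<kappa> * (2 * K + \<kappa> * M)" using l by linarith
      have "d (p i) (q (j k)) \<le> d (p i) (p k) + d (p k) (q (j k))"
        using j[of k] pX qX k i by (intro dist_triangle) auto
      also have "\<dots> \<le> \<kappa> * (i - k) + K"
        using j[of k] k i quasi_geodesic_upper[OF p k(1) i] dist_sym[of "p i" "p k"] pX by (intro add_mono) auto
      also have "\<dots> \<le> K'" unfolding K'_def using ik by (intro add_right_mono mult_left_mono) auto
      finally show ?thesis using k by simp
    qed
    ultimately show ?thesis by (intro exI[of _ J]) auto
  qed
  then show ?thesis by blast
qed

end

section \<open>Word lengths\<close>

lemma word_eval_Nil [simp]: "word_eval G [] = \<one>\<^bsub>G\<^esub>"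
  by (simp add: word_eval_def)

lemma word_eval_Cons [simp]: "word_eval G (s # w) = s \<otimes>\<^bsub>G\<^esub> word_eval G w"
  by (simp add: word_eval_def)

lemma geodesic_path_iff_is_geodesic:
  "geodesic_path G S \<alpha> n a b \<longleftrightarrow> is_geodesic (carrier G) (word_dist G S) \<alpha> n a b"
  by (simp add: geodesic_path_def is_geodesic_def)

lemma word_length_eval_le: "w \<in> lists S \<Longrightarrow> word_length G S (word_eval G w) \<le> length w"
  unfolding word_length_def by (rule Least_le) auto

context group
begin

lemma word_eval_closed: "set w \<subseteq> carrier G \<Longrightarrow> word_eval G w \<in> carrier G"
  by (induction w) auto

lemma word_eval_append:
  "set v \<subseteq> carrier G \<Longrightarrow> set w \<subseteq> carrier G \<Longrightarrow> word_eval G (v @ w) = word_eval G v \<otimes> word_eval G w"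
  by (induction v) (auto simp: m_assoc word_eval_closed)

lemma word_eval_rev_inv:
  "set w \<subseteq> carrier G \<Longrightarrow> word_eval G (rev (map (\<lambda>s. inv s) w)) = inv (word_eval G w)"
proof (induction w)
  case (Cons s w)
  then have "set (rev (map (\<lambda>s. inv s) w)) \<subseteq> carrier G" by auto
  then show ?case using Cons by (simp add: word_eval_append word_eval_closed inv_mult_group)
qed simp

context
  fixes S assumes S: "sym_gen_set G S"
begin

section \<open>The word metric of a fixed generating set\<close>

lemma lists_carrier: "w \<in> lists S \<Longrightarrow> set w \<subseteq> carrier G"
  using S by (auto simp: sym_gen_set_def)

lemma word_ex:
  assumes "g \<in> carrier G"
  shows "\<exists>w\<in>lists S. word_eval G w = g"
proof -
  have "g \<in> generate G S" using S assms by (simp add: sym_gen_set_def)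
  then show ?thesis
  proof (induction rule: generate.induct)
    case one
    then show ?case by (intro bexI[of _ "[]"]) auto
  next
    case (incl h)
    then show ?case using S by (intro bexI[of _ "[h]"]) (auto simp: sym_gen_set_def)
  next
    case (inv h)
    then show ?case using S by (intro bexI[of _ "[inv h]"]) (auto simp: sym_gen_set_def)
  next
    case (eng h1 h2)
    then obtain v w where "v \<in> lists S" "w \<in> lists S" "word_eval G v = h1" "word_eval G w = h2" by blast
    then show ?case
      by (intro bexI[of _ "v @ w"]) (auto simp: word_eval_append lists_carrier simp del: in_lists_conv_set)
  qed
qed

lemma geodesic_word_ex:
  assumes "g \<in> carrier G"
  shows "\<exists>w\<in>lists S. length w = word_length G S g \<and> word_eval G w = g"
proof -
  have "\<exists>n. \<exists>w\<in>lists S. length w = n \<and> word_eval G w = g" using word_ex[OF assms] by blast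
  then show ?thesis unfolding word_length_def by (rule LeastI_ex)
qed

lemma word_length_one: "word_length G S \<one> = 0"
  using word_length_eval_le[of "[]" S G] by simp

lemma word_length_mult_le:
  assumes "g \<in> carrier G" "h \<in> carrier G"
  shows "word_length G S (g \<otimes> h) \<le> word_length G S g + word_length G S h"
proof -
  obtain v w where vw: "v \<in> lists S" "length v = word_length G S g" "word_eval G v = g"
    "w \<in> lists S" "length w = word_length G S h" "word_eval G w = h"
    using geodesic_word_ex assms by blast
  then show ?thesis
    using word_length_eval_le[of "v @ w" S G] word_eval_append[OF lists_carrier lists_carrier, of v w] by simp
qed

lemma word_length_inv_le:
  assumes "g \<in> carrier G"
  shows "word_length G S (inv g) \<le> word_length G S g"
proof -
  obtain w where w: "w \<in> lists S" "length w = word_length G S g" "word_eval G w = g"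
    using geodesic_word_ex assms by blast
  then have "rev (map (\<lambda>s. inv s) w) \<in> lists S" using S by (auto simp: sym_gen_set_def)
  from word_length_eval_le[OF this, of G] show ?thesis
    using w word_eval_rev_inv[OF lists_carrier[OF w(1)]] by simp
qed

lemma word_length_inv: "g \<in> carrier G \<Longrightarrow> word_length G S (inv g) = word_length G S g"
  using word_length_inv_le[of g] word_length_inv_le[of "inv g"] by simp

lemma word_dist_self: "a \<in> carrier G \<Longrightarrow> word_dist G S a a = 0"
  by (simp add: word_dist_def word_length_one)

lemma word_dist_sym: "a \<in> carrier G \<Longrightarrow> b \<in> carrier G \<Longrightarrow> word_dist G S a b = word_dist G S b a"
  using word_length_inv[of "inv a \<otimes> b"] by (simp add: word_dist_def inv_mult_group)

lemma word_dist_triangle: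
  assumes "a \<in> carrier G" "b \<in> carrier G" "c \<in> carrier G"
  shows "word_dist G S a c \<le> word_dist G S a b + word_dist G S b c"
proof -
  have "inv a \<otimes> c = (inv a \<otimes> b) \<otimes> (inv b \<otimes> c)"
    using assms by (simp add: inv_solve_left m_assoc) (simp add: m_assoc[symmetric])
  then show ?thesis unfolding word_dist_def using assms word_length_mult_le by simp
qed

lemma word_dist_translate:
  "a \<in> carrier G \<Longrightarrow> b \<in> carrier G \<Longrightarrow> c \<in> carrier G \<Longrightarrow> word_dist G S (a \<otimes> b) (a \<otimes> c) = word_dist G S b c"
proof -
  assume a: "a \<in> carrier G" "b \<in> carrier G" "c \<in> carrier G"
  have "inv (a \<otimes> b) \<otimes> (a \<otimes> c) = inv b \<otimes> (inv a \<otimes> a) \<otimes> c"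
    using a by (simp only: inv_mult_group m_assoc m_closed inv_closed)
  then show ?thesis using a by (simp add: word_dist_def)
qed

lemma finite_word_ball: "finite {g \<in> carrier G. word_length G S g \<le> K}"
proof -
  have "{g \<in> carrier G. word_length G S g \<le> K} \<subseteq> word_eval G ` {w. set w \<subseteq> S \<and> length w \<le> K}"
    using geodesic_word_ex by (fastforce simp: in_lists_conv_set)
  moreover have "finite {w. set w \<subseteq> S \<and> length w \<le> K}"
    using S by (intro finite_lists_length_le) (simp add: sym_gen_set_def)
  ultimately show ?thesis using finite_surj by blast
qed

text \<open>Subwords of a geodesic word are geodesic: the letters between positions \<open>i\<close>
  and \<open>j\<close> give the upper bound, and a shorter middle piece would shorten
  \<open>w\<close> itself.\<close>

lemma geodesic_word_dist:
  assumes "w \<in> lists S" "length w = word_length G S (word_eval G w)" "i \<le> j" "j \<le> length w"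
  shows "word_dist G S (word_eval G (take i w)) (word_eval G (take j w)) = j - i"
proof -
  let ?e = "\<lambda>i. word_eval G (take i w)"
  have c: "?e i \<in> carrier G" for i
    using lists_carrier[OF assms(1)] set_take_subset[of i w] by (intro word_eval_closed) blast
  define x where "x = take (j - i) (drop i w)"
  have "take j w = take i w @ x" using assms(3) by (simp add: x_def take_add[symmetric])
  moreover have xS: "x \<in> lists S"
    using assms(1) set_take_subset[of "j - i" "drop i w"] set_drop_subset[of i w] by (auto simp: x_def)
  moreover have tS: "take k w \<in> lists S" "drop k w \<in> lists S" for k
    using assms(1) set_take_subset[of k w] set_drop_subset[of k w] by auto
  ultimately have "?e j = ?e i \<otimes> word_eval G x" by (simp add: word_eval_append lists_carrier del: in_lists_conv_set)
  then have e: "inv (?e i) \<otimes> ?e j = word_eval G x"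
    using c[of i] word_eval_closed[OF lists_carrier[OF xS]] by (simp add: inv_solve_left m_assoc[symmetric])
  have le: "word_dist G S (?e i) (?e j) \<le> j - i"
    using word_length_eval_le[OF xS, of G] assms by (simp add: word_dist_def e x_def)
  have "word_eval G w = ?e j \<otimes> word_eval G (drop j w)"
    using word_eval_append[OF lists_carrier lists_carrier, OF tS, of j j] by simp
  also have "\<dots> = ?e i \<otimes> (inv (?e i) \<otimes> ?e j) \<otimes> word_eval G (drop j w)"
    using c[of i] c[of j] by (simp add: m_assoc[symmetric])
  finally have "word_length G S (word_eval G w) \<le> word_length G S (?e i \<otimes> (inv (?e i) \<otimes> ?e j)) + word_length G S (word_eval G (drop j w))"
    using word_length_mult_le[of "?e i \<otimes> (inv (?e i) \<otimes> ?e j)" "word_eval G (drop j w)"] c[of i] c[of j]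
      word_eval_closed[OF lists_carrier[OF tS(2)], of j] by simp
  also have "word_length G S (?e i \<otimes> (inv (?e i) \<otimes> ?e j)) \<le> word_length G S (?e i) + word_dist G S (?e i) (?e j)"
    unfolding word_dist_def using word_length_mult_le[of "?e i" "inv (?e i) \<otimes> ?e j"] c[of i] c[of j] by simp
  also have "word_length G S (?e i) \<le> i" using word_length_eval_le[OF tS(1), of G i] by simp
  also have "word_length G S (word_eval G (drop j w)) \<le> length w - j" using word_length_eval_le[OF tS(2), of G j] by simp
  finally have "length w \<le> i + word_dist G S (?e i) (?e j) + (length w - j)" using assms(2) by simp
  then show ?thesis using le assms by linarith
qed

text \<open>A subadditive function is bounded along a word by its maximum on the letters. With
  \<open>f\<close> the length for another generating set this compares the two word metrics.\<close>

lemma word_length_linear_bound: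
  assumes "\<And>g h. g \<in> carrier G \<Longrightarrow> h \<in> carrier G \<Longrightarrow> f (g \<otimes> h) \<le> f g + f h" "f \<one> = (0::nat)"
  shows "\<exists>\<kappa>. \<forall>g\<in>carrier G. f g \<le> \<kappa> * word_length G S g"
proof -
  have "finite (f ` S)" using S by (simp add: sym_gen_set_def)
  then obtain \<kappa> where \<kappa>: "\<And>s. s \<in> S \<Longrightarrow> f s \<le> \<kappa>" by (auto simp: finite_nat_set_iff_bounded_le)
  have "f (word_eval G w) \<le> \<kappa> * length w" if "w \<in> lists S" for w
    using that
  proof (induction w)
    case (Cons s w)
    then have "f (word_eval G (s # w)) \<le> f s + f (word_eval G w)"
      using assms(1)[of s "word_eval G w"] word_eval_closed[OF lists_carrier] S by (auto simp: sym_gen_set_def)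
    then show ?case using Cons \<kappa>[of s] by auto
  qed (simp add: assms)
  then show ?thesis using geodesic_word_ex by metis
qed

text \<open>The prefixes of a shortest word for \<open>inv a \<otimes> b\<close>, translated by
  \<open>a\<close>.\<close>

lemma word_metric_geodesic_ex:
  assumes "a \<in> carrier G" "b \<in> carrier G"
  shows "\<exists>\<alpha> n. is_geodesic (carrier G) (word_dist G S) \<alpha> n a b"
proof -
  obtain w where w: "w \<in> lists S" "length w = word_length G S (inv a \<otimes> b)" "word_eval G w = inv a \<otimes> b"
    using geodesic_word_ex assms by blast
  have c: "word_eval G (take i w) \<in> carrier G" for i
    using lists_carrier[OF w(1)] set_take_subset[of i w] by (intro word_eval_closed) blast
  have "is_geodesic (carrier G) (word_dist G S) (\<lambda>i. a \<otimes> word_eval G (take i w)) (length w) a b"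
    unfolding is_geodesic_def
    using assms c w geodesic_word_dist[OF w(1)] by (auto simp: word_dist_translate m_assoc[symmetric])
  then show ?thesis by blast
qed

end

section \<open>Slim word metrics and change of generators\<close>

lemma slim_geodesic_space_word_metric:
  assumes "sym_gen_set G S" "slim_triangles G S \<delta>"
  shows "slim_geodesic_space (carrier G) (word_dist G S) \<delta>"
proof
  show "(\<exists>j\<le>m. word_dist G S (\<alpha> i) (\<beta> j) \<le> \<delta>) \<or> (\<exists>k\<le>n. word_dist G S (\<alpha> i) (\<gamma> k) \<le> \<delta>)"
    if "is_geodesic (carrier G) (word_dist G S) \<alpha> l a b" "is_geodesic (carrier G) (word_dist G S) \<beta> m b c"
      "is_geodesic (carrier G) (word_dist G S) \<gamma> n c a" "i \<le> l" for \<alpha> l a b \<beta> m c \<gamma> n i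
    using assms(2) that unfolding slim_triangles_def geodesic_path_iff_is_geodesic by blast
qed (use word_dist_self word_dist_sym word_dist_triangle word_metric_geodesic_ex assms(1) in auto)

lemma geodesic_words_quasi_geodesic:
  assumes "sym_gen_set G S0" "sym_gen_set G S"
  shows "\<exists>\<kappa>0. \<forall>\<kappa>\<ge>\<kappa>0. \<forall>w\<in>lists S. length w = word_length G S (word_eval G w) \<longrightarrow>
    quasi_geodesic (carrier G) (word_dist G S0) \<kappa> (\<lambda>i. word_eval G (take i w)) (length w)"
proof -
  obtain \<kappa>1 where 1: "\<And>g. g \<in> carrier G \<Longrightarrow> word_length G S0 g \<le> \<kappa>1 * word_length G S g"
    using word_length_linear_bound[OF assms(2), of "word_length G S0"] word_length_one word_length_mult_le assms(1) by metis
  obtain \<kappa>2 where 2: "\<And>g. g \<in> carrier G \<Longrightarrow> word_length G S g \<le> \<kappa>2 * word_length G S0 g"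
    using word_length_linear_bound[OF assms(1), of "word_length G S"] word_length_one word_length_mult_le assms(2) by metis
  have "quasi_geodesic (carrier G) (word_dist G S0) \<kappa> (\<lambda>i. word_eval G (take i w)) (length w)"
    if \<kappa>: "\<kappa> \<ge> max \<kappa>1 \<kappa>2" and w: "w \<in> lists S" "length w = word_length G S (word_eval G w)" for \<kappa> w
    unfolding quasi_geodesic_def
  proof (intro conjI allI impI)
    show c: "word_eval G (take i w) \<in> carrier G" for i
      using lists_carrier[OF assms(2) w(1)] set_take_subset[of i w] by (intro word_eval_closed) blast
    note d = geodesic_word_dist[OF assms(2) w]
    have d1: "word_dist G S0 a b \<le> \<kappa>1 * word_dist G S a b" if "a \<in> carrier G" "b \<in> carrier G" for a b
      using 1 that by (simp add: word_dist_def)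
    have d2: "word_dist G S a b \<le> \<kappa>2 * word_dist G S0 a b" if "a \<in> carrier G" "b \<in> carrier G" for a b
      using 2 that by (simp add: word_dist_def)
    show "word_dist G S0 (word_eval G (take i w)) (word_eval G (take (Suc i) w)) \<le> \<kappa>" if "i < length w" for i
      using d1[OF c c, of i "Suc i"] d[of i "Suc i"] \<kappa> that by simp
    show "j - i \<le> \<kappa> * word_dist G S0 (word_eval G (take i w)) (word_eval G (take j w))" if "i \<le> j" "j \<le> length w" for i j
    proof -
      have "j - i \<le> \<kappa>2 * word_dist G S0 (word_eval G (take i w)) (word_eval G (take j w))"
        using d2[OF c c, of i j] d[OF that] by simp
      also have "\<dots> \<le> \<kappa> * word_dist G S0 (word_eval G (take i w)) (word_eval G (take j w))"
        using \<kappa> by (intro mult_right_mono) auto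
      finally show ?thesis .
    qed
  qed
  then show ?thesis by blast
qed

end

section \<open>Labelled digraphs as finite quotients of a language\<close>

text \<open>A digraph parameterizing \<open>L\<close> amounts to a right congruence of finite index on \<open>L\<close>, given by
  the fibres of \<open>st\<close>; the last clause says that the increments of \<open>h\<close> are functions on the edges.\<close>

definition state_map :: "'a list set \<Rightarrow> ('a list \<Rightarrow> 'q) \<Rightarrow> ('a list \<Rightarrow> int) \<Rightarrow> bool" where
  "state_map L st h \<longleftrightarrow> finite (st ` L) \<and>
     (\<forall>u\<in>L. \<forall>v\<in>L. st u = st v \<longrightarrow> (\<forall>s. u @ [s] \<in> L \<longrightarrow>
        v @ [s] \<in> L \<and> st (u @ [s]) = st (v @ [s]) \<and> h (u @ [s]) - h u = h (v @ [s]) - h v))"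

lemma state_map_snoc:
  assumes "state_map L st h" "u \<in> L" "v \<in> L" "st u = st v" "u @ [s] \<in> L"
  shows "v @ [s] \<in> L \<and> st (u @ [s]) = st (v @ [s]) \<and> h (u @ [s]) - h u = h (v @ [s]) - h v"
  using assms unfolding state_map_def by blast

text \<open>The increments of \<open>h\<close> telescope along \<open>x\<close>. Whole blocks are
  needed because a word of \<open>L\<close> may advance by several letters while one letter of a
  word of \<open>L'\<close> is read.\<close>

lemma state_map_append:
  assumes "state_map L st h" "prefix_closed L" "u \<in> L" "v \<in> L" "st u = st v" "u @ x \<in> L"
  shows "v @ x \<in> L \<and> st (u @ x) = st (v @ x) \<and> h (u @ x) - h u = h (v @ x) - h v"
  using assms(6)
proof (induction x rule: rev_induct)
  case Nil
  then show ?case using assms by simp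
next
  case (snoc s x)
  have u: "u @ x \<in> L" using assms(2) snoc.prems by (auto simp: prefix_closed_def prefix_def)
  from snoc.IH[OF this] have IH: "v @ x \<in> L" "st (u @ x) = st (v @ x)" "h (u @ x) - h u = h (v @ x) - h v"
    by auto
  have "(v @ x) @ [s] \<in> L \<and> st ((u @ x) @ [s]) = st ((v @ x) @ [s]) \<and>
      h ((u @ x) @ [s]) - h (u @ x) = h ((v @ x) @ [s]) - h (v @ x)"
    using snoc.prems by (intro state_map_snoc[OF assms(1) u IH(1,2)]) simp
  then show ?case using IH by auto
qed

lemma path_for_take: "path_for \<Gamma> w \<gamma> \<Longrightarrow> path_for \<Gamma> (take i w) \<gamma>"
  by (auto simp: path_for_def)

lemma path_for_unique:
  assumes "labeled_digraph_over S \<Gamma>" "path_for \<Gamma> w \<gamma>" "path_for \<Gamma> w \<gamma>'" "i \<le> length w"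
  shows "\<gamma> i = \<gamma>' i"
  using assms(4)
proof (induction i)
  case 0
  then show ?case using assms by (auto simp: path_for_def)
next
  case (Suc i)
  have "(\<gamma> i, w ! i, \<gamma> (Suc i)) \<in> edges \<Gamma>" "(\<gamma>' i, w ! i, \<gamma>' (Suc i)) \<in> edges \<Gamma>"
    using assms(2,3) Suc.prems by (simp_all add: path_for_def)
  moreover have "\<gamma> i = \<gamma>' i" using Suc by simp
  ultimately show ?case using assms(1) unfolding labeled_digraph_over_def by metis
qed

lemma path_for_snoc:
  assumes "path_for \<Gamma> w \<gamma>" "(\<gamma> (length w), s, v) \<in> edges \<Gamma>"
  shows "path_for \<Gamma> (w @ [s]) (\<gamma>(Suc (length w) := v))"
  using assms by (auto simp: path_for_def nth_append less_Suc_eq)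

lemma path_for_end_in_verts:
  assumes "labeled_digraph_over S \<Gamma>" "path_for \<Gamma> w \<gamma>"
  shows "\<gamma> (length w) \<in> verts \<Gamma>"
proof (cases "length w")
  case 0
  then show ?thesis using assms by (auto simp: path_for_def labeled_digraph_over_def)
next
  case (Suc n)
  then have "(\<gamma> n, w ! n, \<gamma> (Suc n)) \<in> edges \<Gamma>" using assms(2) by (auto simp: path_for_def)
  then show ?thesis using assms(1) Suc by (auto simp: labeled_digraph_over_def)
qed

text \<open>The state of a word is the vertex it leads to, which by determinism does not depend on
  the chosen path. Appending a letter changes \<open>h\<close> by the weight of the vertex reached,
  so the edge determines the increment.\<close>

lemma parameterizes_state_map:
  assumes \<Gamma>: "parameterizes S \<Gamma> L"
    and h: "\<And>w \<gamma>. w \<in> L \<Longrightarrow> path_for \<Gamma> w \<gamma> \<Longrightarrow> h w = (\<Sum>i=0..length w. c (\<gamma> i))"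
  shows "\<exists>st :: 'a list \<Rightarrow> nat. state_map L st h"
proof -
  have over: "labeled_digraph_over S \<Gamma>" and L: "L = {w. \<exists>\<gamma>. path_for \<Gamma> w \<gamma>}"
    using \<Gamma> by (auto simp: parameterizes_def)
  define st where "st w = (SOME \<gamma>. path_for \<Gamma> w \<gamma>) (length w)" for w
  have st: "st w = \<gamma> (length w)" if "path_for \<Gamma> w \<gamma>" for w \<gamma>
    unfolding st_def using path_for_unique[OF over someI[of "path_for \<Gamma> w", OF that] that, of "length w"] by simp
  have step: "v @ [s] \<in> L \<and> st (v @ [s]) = q \<and> h (v @ [s]) = h v + c q"
    if "v \<in> L" "(st v, s, q) \<in> edges \<Gamma>" for v s q
  proof -
    obtain \<gamma> where \<gamma>: "path_for \<Gamma> v \<gamma>" using \<open>v \<in> L\<close> L by blast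
    define \<gamma>' where "\<gamma>' = \<gamma>(Suc (length v) := q)"
    have \<gamma>': "path_for \<Gamma> (v @ [s]) \<gamma>'"
      unfolding \<gamma>'_def using that(2) st[OF \<gamma>] by (intro path_for_snoc[OF \<gamma>]) auto
    then have vs: "v @ [s] \<in> L" using L by blast
    have "h (v @ [s]) = (\<Sum>i=0..length v. c (\<gamma>' i)) + c q" using h[OF vs \<gamma>'] by (simp add: \<gamma>'_def)
    also have "(\<Sum>i=0..length v. c (\<gamma>' i)) = (\<Sum>i=0..length v. c (\<gamma> i))"
      by (intro sum.cong) (auto simp: \<gamma>'_def)
    finally show ?thesis using vs st[OF \<gamma>'] h[OF that(1) \<gamma>] by (simp add: \<gamma>'_def)
  qed
  have edge: "(st u, s, st (u @ [s])) \<in> edges \<Gamma>" if "u @ [s] \<in> L" for u s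
  proof -
    obtain \<gamma> where \<gamma>: "path_for \<Gamma> (u @ [s]) \<gamma>" using \<open>u @ [s] \<in> L\<close> L by blast
    then have "path_for \<Gamma> u \<gamma>" using path_for_take[of \<Gamma> "u @ [s]" \<gamma> "length u"] by simp
    then have "st u = \<gamma> (length u)" by (rule st)
    moreover have "st (u @ [s]) = \<gamma> (Suc (length u))" using st[OF \<gamma>] by simp
    ultimately show ?thesis using \<gamma> by (auto simp: path_for_def dest: spec[of _ "length u"])
  qed
  have "st ` L \<subseteq> verts \<Gamma>" using st path_for_end_in_verts[OF over] L by fastforce
  then have "finite (st ` L)" using over by (auto simp: labeled_digraph_over_def intro: finite_subset)
  moreover have "v @ [s] \<in> L \<and> st (u @ [s]) = st (v @ [s]) \<and> h (u @ [s]) - h u = h (v @ [s]) - h v"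
    if "u \<in> L" "v \<in> L" "st u = st v" "u @ [s] \<in> L" for u v s
    using step[OF that(1) edge[OF that(4)]] step[OF that(2), of s "st (u @ [s])"] edge[OF that(4)] that(3) by auto
  ultimately have "state_map L st h" unfolding state_map_def by blast
  then show ?thesis by blast
qed

text \<open>A vertex function is summed over the vertices of a path, so each state has to remember the last
  increment of \<open>h\<close>; the initial vertex carries the constant term \<open>h []\<close>.\<close>

lemma state_map_parameterizes:
  fixes st :: "'a list \<Rightarrow> 'q"
  assumes st: "state_map L st h" and L: "L \<subseteq> lists S" "prefix_closed L" "[] \<in> L" and S: "finite S"
  shows "\<exists>\<Gamma> c. parameterizes S \<Gamma> L \<and>
    (\<forall>w\<in>L. \<forall>\<gamma>. path_for \<Gamma> w \<gamma> \<longrightarrow> h w = (\<Sum>i=0..length w. c (\<gamma> i)))"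
proof -
  define inc where "inc w = (if w = [] then h [] else h w - h (butlast w))" for w
  define f where "f w = (st w, inc w)" for w
  have step: "v @ [s] \<in> L \<and> f (u @ [s]) = f (v @ [s])" if "u \<in> L" "v \<in> L" "st u = st v" "u @ [s] \<in> L" for u v s
    using state_map_snoc[OF st that] by (simp add: f_def inc_def)
  have Lbut: "u \<in> L" if "u @ [s] \<in> L" for u s using L(2) that by (auto simp: prefix_closed_def prefix_def)
  \<comment> \<open>The increments take only finitely many values: the pair \<open>f\<close> of a
    nonempty word depends only on the state before the last letter and on that letter.
    \<open>ext\<close> computes it from an arbitrary representative of the state.\<close>
  have fin: "finite (f ` L)"
  proof -
    define ext where "ext = (\<lambda>(q, s). f ((SOME v. v \<in> L \<and> st v = q \<and> v @ [s] \<in> L) @ [s]))"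
    have "f ` L \<subseteq> insert (f []) (ext ` (st ` L \<times> S))"
    proof
      fix y assume "y \<in> f ` L"
      then obtain w where w: "w \<in> L" "y = f w" by blast
      show "y \<in> insert (f []) (ext ` (st ` L \<times> S))"
      proof (cases w rule: rev_cases)
        case (snoc u s)
        have u: "u \<in> L" "s \<in> S" "u @ [s] \<in> L" using w snoc Lbut L(1) by auto
        define v where "v = (SOME v. v \<in> L \<and> st v = st u \<and> v @ [s] \<in> L)"
        have v: "v \<in> L \<and> st v = st u \<and> v @ [s] \<in> L" unfolding v_def by (rule someI[of _ u]) (use u in auto)
        have "ext (st u, s) = f (v @ [s])" by (simp add: ext_def v_def)
        also have "\<dots> = f (u @ [s])" using step[of u v s] u v by metis
        finally have "y = ext (st u, s)" using w snoc by simp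
        then show ?thesis using u by (intro insertI2 image_eqI[of _ _ "(st u, s)"]) auto
      qed (use w in auto)
    qed
    moreover have "finite (insert (f []) (ext ` (st ` L \<times> S)))"
      using st S by (simp add: state_map_def)
    ultimately show ?thesis by (rule finite_subset)
  qed
  \<comment> \<open>Vertices have to be natural numbers, so the finitely many pairs are numbered;
    \<open>c\<close> below decodes the stored increment.\<close>
  obtain e :: "'q \<times> int \<Rightarrow> nat" where e: "inj_on e (f ` L)"
    using fin finite_imp_inj_to_nat_seg by metis
  have e_iff: "e (f u) = e (f v) \<longleftrightarrow> f u = f v" if "u \<in> L" "v \<in> L" for u v
    using e that by (auto simp: inj_on_eq_iff)
  define \<Gamma> where "\<Gamma> = \<lparr>verts = e ` f ` L, edges = {(e (f u), s, e (f (u @ [s]))) |u s. u @ [s] \<in> L}, init = e (f [])\<rparr>"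
  define c where "c n = snd (the_inv_into (f ` L) e n)" for n
  have c: "c (e (f w)) = inc w" if "w \<in> L" for w
    using the_inv_into_f_f[OF e, of "f w"] that by (simp add: c_def f_def)
  have edgeI: "(e (f u), s, e (f (u @ [s]))) \<in> edges \<Gamma>" if "u @ [s] \<in> L" for u s
    using that by (auto simp: \<Gamma>_def)
  \<comment> \<open>An edge leaving the vertex of \<open>v\<close> may have been contributed by
    another word with the same vertex; the congruence property moves it to \<open>v\<close>.\<close>
  have edgeD: "v @ [s] \<in> L \<and> q = e (f (v @ [s]))" if "(e (f v), s, q) \<in> edges \<Gamma>" "v \<in> L" for v s q
  proof -
    obtain u where u: "u @ [s] \<in> L" "e (f v) = e (f u)" "q = e (f (u @ [s]))"
      using \<open>(e (f v), s, q) \<in> edges \<Gamma>\<close> by (auto simp: \<Gamma>_def)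
    then have "st u = st v" using e_iff[OF that(2) Lbut[OF u(1)]] by (simp add: f_def)
    from step[OF Lbut[OF u(1)] that(2) this u(1)] u show ?thesis by simp
  qed
  have over: "labeled_digraph_over S \<Gamma>"
    unfolding labeled_digraph_over_def
  proof (intro conjI allI impI)
    show "finite (verts \<Gamma>)" using fin by (simp add: \<Gamma>_def)
    show "init \<Gamma> \<in> verts \<Gamma>" using L by (simp add: \<Gamma>_def)
    show "edges \<Gamma> \<subseteq> verts \<Gamma> \<times> S \<times> verts \<Gamma>" using L Lbut by (fastforce simp: \<Gamma>_def)
    fix a s b b' assume a: "(a, s, b) \<in> edges \<Gamma>" "(a, s, b') \<in> edges \<Gamma>"
    then obtain v where "v \<in> L" "a = e (f v)" using Lbut by (auto simp: \<Gamma>_def)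
    then show "b = b'" using edgeD[of v s] a by auto
  qed
  have path_L: "\<gamma> i = e (f (take i w)) \<and> take i w \<in> L" if \<gamma>: "path_for \<Gamma> w \<gamma>" and i: "i \<le> length w" for w \<gamma> i
    using i
  proof (induction i)
    case 0
    then show ?case using \<gamma> L by (simp add: path_for_def \<Gamma>_def)
  next
    case (Suc i)
    then have i: "\<gamma> i = e (f (take i w))" "take i w \<in> L" by simp_all
    have "(\<gamma> i, w ! i, \<gamma> (Suc i)) \<in> edges \<Gamma>" using \<gamma> Suc.prems by (simp add: path_for_def)
    then have "take i w @ [w ! i] \<in> L \<and> \<gamma> (Suc i) = e (f (take i w @ [w ! i]))"
      unfolding i(1) by (rule edgeD[OF _ i(2)])
    then show ?case using Suc.prems by (simp add: take_Suc_conv_app_nth)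
  qed
  have "path_for \<Gamma> w (\<lambda>i. e (f (take i w)))" if "w \<in> L" for w
  proof -
    have "take (Suc i) w \<in> L" for i using L(2) that take_is_prefix[of "Suc i" w] by (auto simp: prefix_closed_def)
    then have "(e (f (take i w)), w ! i, e (f (take (Suc i) w))) \<in> edges \<Gamma>" if "i < length w" for i
      using edgeI[of "take i w" "w ! i"] that by (simp add: take_Suc_conv_app_nth[symmetric])
    then show ?thesis by (simp add: path_for_def \<Gamma>_def)
  qed
  moreover have "w \<in> L" if "path_for \<Gamma> w \<gamma>" for w \<gamma> using path_L[OF that, of "length w"] by simp
  ultimately have "parameterizes S \<Gamma> L" using over unfolding parameterizes_def by blast
  moreover have "h w = (\<Sum>i=0..length w. c (\<gamma> i))" if \<gamma>: "path_for \<Gamma> w \<gamma>" for w \<gamma>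
  proof -
    have "h (take n w) = (\<Sum>i=0..n. c (\<gamma> i))" if "n \<le> length w" for n
      using that
    proof (induction n)
      case 0
      then show ?case using path_L[OF \<gamma>, of 0] c L by (simp add: inc_def)
    next
      case (Suc n)
      have "c (\<gamma> (Suc n)) = h (take (Suc n) w) - h (take n w)"
        using path_L[OF \<gamma>, of "Suc n"] Suc.prems c[of "take (Suc n) w"]
        by (auto simp: inc_def take_Suc_conv_app_nth butlast_append)
      then show ?case using Suc by simp
    qed
    then show ?thesis by force
  qed
  ultimately show ?thesis by blast
qed

section \<open>Transferring combings\<close>

text \<open>Each letter \<open>s\<close> of \<open>u\<close> is matched with a possibly empty block
  \<open>x\<close> of \<open>w\<close>, which encodes a monotone reparametrization. The recursion on
  the last letter is the form in which an automaton reading \<open>u\<close> can follow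
  \<open>w\<close>.\<close>

inductive fellow_travels :: "('a, 'b) monoid_scheme \<Rightarrow> 'a set \<Rightarrow> nat \<Rightarrow> 'a list \<Rightarrow> 'a list \<Rightarrow> bool"
  for G T K where
  Nil: "fellow_travels G T K [] []"
| snoc: "fellow_travels G T K u w \<Longrightarrow> word_dist G T (word_eval G (u @ [s])) (word_eval G (w @ x)) \<le> K \<Longrightarrow>
    fellow_travels G T K (u @ [s]) (w @ x)"

lemma fellow_travels_snocE:
  assumes "fellow_travels G T K (u @ [s]) w"
  obtains w1 x where "w = w1 @ x" "fellow_travels G T K u w1"
    "word_dist G T (word_eval G (u @ [s])) (word_eval G w) \<le> K"
  using assms by (cases rule: fellow_travels.cases) auto

context group
begin

lemma fellow_travels_dist:
  "sym_gen_set G T \<Longrightarrow> fellow_travels G T K u w \<Longrightarrow> word_dist G T (word_eval G u) (word_eval G w) \<le> K"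
  by (erule fellow_travels.cases) (auto simp: word_dist_self)

text \<open>Choose \<open>T\<close> with slim triangles. Both words are quasi-geodesics for the
  metric of \<open>T\<close>, and the monotone indices \<open>J\<close> cut \<open>w\<close> into
  the blocks.\<close>

lemma geodesic_words_fellow_travel:
  assumes "hyperbolic_group G" "sym_gen_set G S" "sym_gen_set G S'"
  shows "\<exists>T K. sym_gen_set G T \<and> (\<forall>u\<in>lists S'. \<forall>w\<in>lists S. length u = word_length G S' (word_eval G u) \<longrightarrow>
    length w = word_length G S (word_eval G w) \<longrightarrow> word_eval G u = word_eval G w \<longrightarrow> fellow_travels G T K u w)"
proof -
  obtain T \<delta> where T: "sym_gen_set G T" "slim_triangles G T \<delta>"
    using assms(1) by (auto simp: hyperbolic_group_def)
  interpret slim_geodesic_space "carrier G" "word_dist G T" \<delta>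
    by (rule slim_geodesic_space_word_metric[OF T])
  let ?qg = "\<lambda>\<kappa> w. quasi_geodesic (carrier G) (word_dist G T) \<kappa> (\<lambda>i. word_eval G (take i w)) (length w)"
  obtain \<kappa>1 where 1: "\<And>w \<kappa>. \<kappa> \<ge> \<kappa>1 \<Longrightarrow> w \<in> lists S \<Longrightarrow> length w = word_length G S (word_eval G w) \<Longrightarrow> ?qg \<kappa> w"
    using geodesic_words_quasi_geodesic[OF T(1) assms(2)] by blast
  obtain \<kappa>2 where 2: "\<And>w \<kappa>. \<kappa> \<ge> \<kappa>2 \<Longrightarrow> w \<in> lists S' \<Longrightarrow> length w = word_length G S' (word_eval G w) \<Longrightarrow> ?qg \<kappa> w"
    using geodesic_words_quasi_geodesic[OF T(1) assms(3)] by blast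
  \<comment> \<open>Large enough for both generating sets and at least one.\<close>
  define \<kappa> where "\<kappa> = Suc (\<kappa>1 + \<kappa>2)"
  have "\<kappa> \<ge> 1" by (simp add: \<kappa>_def)
  obtain K M where KM: "\<And>p n q m. quasi_geodesic (carrier G) (word_dist G T) \<kappa> p n \<Longrightarrow>
      quasi_geodesic (carrier G) (word_dist G T) \<kappa> q m \<Longrightarrow> p 0 = q 0 \<Longrightarrow> p n = q m \<Longrightarrow>
      \<exists>J. J 0 = 0 \<and> J n = m \<and> (\<forall>i<n. J i \<le> J (Suc i) \<and> J (Suc i) \<le> J i + M) \<and>
         (\<forall>i\<le>n. J i \<le> m \<and> word_dist G T (p i) (q (J i)) \<le> K)"
    using quasi_geodesics_fellow_travel[OF \<open>\<kappa> \<ge> 1\<close>] by blast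
  have "fellow_travels G T K u w"
    if u: "u \<in> lists S'" "length u = word_length G S' (word_eval G u)"
      and w: "w \<in> lists S" "length w = word_length G S (word_eval G w)"
      and eq: "word_eval G u = word_eval G w" for u w
  proof -
    obtain J where J: "J 0 = 0" "J (length u) = length w" "\<And>i. i < length u \<Longrightarrow> J i \<le> J (Suc i)"
      "\<And>i. i \<le> length u \<Longrightarrow> J i \<le> length w \<and> word_dist G T (word_eval G (take i u)) (word_eval G (take (J i) w)) \<le> K"
      using KM[OF 2[OF _ u, of \<kappa>] 1[OF _ w, of \<kappa>]] eq by (auto simp: \<kappa>_def)
    have "fellow_travels G T K (take i u) (take (J i) w)" if "i \<le> length u" for i
      using that
    proof (induction i)
      case 0
      then show ?case using J by (simp add: fellow_travels.Nil)
    next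
      case (Suc i)
      have w: "take (J (Suc i)) w = take (J i) w @ take (J (Suc i) - J i) (drop (J i) w)"
        using J(3)[of i] Suc.prems by (simp add: take_add[symmetric])
      have u: "take (Suc i) u = take i u @ [u ! i]" using Suc.prems by (simp add: take_Suc_conv_app_nth)
      show ?case
        unfolding u w using Suc J(4)[of "Suc i"] by (intro fellow_travels.snoc) (auto simp: u[symmetric] w[symmetric])
    qed
    from this[of "length u"] show ?thesis using J by simp
  qed
  then show ?thesis using T(1) by blast
qed

section \<open>Lipschitz bounds under change of generators\<close>

text \<open>Bounds for single elements add up under products, so every group element has one, and a
  finite set has a common one. It serves both to change generators and to bound
  \<open>\<phi>\<close> across a ball.\<close>

lemma bounded_increments:
  assumes S: "sym_gen_set G S" and C: "\<forall>a\<in>carrier G. \<forall>s\<in>S. \<bar>\<phi> (a \<otimes> s) - \<phi> a\<bar> \<le> (C::int)"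
    and B: "finite B" "B \<subseteq> carrier G"
  shows "\<exists>C. \<forall>a\<in>carrier G. \<forall>b\<in>B. \<bar>\<phi> (a \<otimes> b) - \<phi> a\<bar> \<le> C"
proof -
  have "\<exists>C. \<forall>a\<in>carrier G. \<bar>\<phi> (a \<otimes> b) - \<phi> a\<bar> \<le> C" if "b \<in> carrier G" for b
  proof -
    have SG: "S \<subseteq> carrier G" and "b \<in> generate G S" using S that by (auto simp: sym_gen_set_def)
    from this(2) show ?thesis
    proof (induction rule: generate.induct)
      case one
      then show ?case by (intro exI[of _ 0]) simp
    next
      case (incl h)
      then show ?case using C by blast
    next
      case (inv h)
      then have "inv h \<in> S" using S by (simp add: sym_gen_set_def)
      then show ?case using C by blast
    next
      case (eng g h)
      then obtain c e where ce: "\<forall>a\<in>carrier G. \<bar>\<phi> (a \<otimes> g) - \<phi> a\<bar> \<le> c" "\<forall>a\<in>carrier G. \<bar>\<phi> (a \<otimes> h) - \<phi> a\<bar> \<le> e"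
        by blast
      have gh: "g \<in> carrier G" "h \<in> carrier G" using eng generate_in_carrier[OF SG] by auto
      have "\<bar>\<phi> (a \<otimes> (g \<otimes> h)) - \<phi> a\<bar> \<le> c + e" if "a \<in> carrier G" for a
        using ce(1)[rule_format, of a] ce(2)[rule_format, of "a \<otimes> g"] that gh by (simp add: m_assoc)
      then show ?case by blast
    qed
  qed
  then obtain c where c: "\<And>a b. b \<in> B \<Longrightarrow> a \<in> carrier G \<Longrightarrow> \<bar>\<phi> (a \<otimes> b) - \<phi> a\<bar> \<le> c b"
    using B(2) by (metis subsetD)
  have "c b \<le> Max (c ` B)" if "b \<in> B" for b using B(1) that by simp
  then show ?thesis using c by (meson order_trans)
qed

text \<open>Inversion exchanges left and right multiplication, so the right-handed bound is applied
  to \<open>\<psi>\<close>.\<close>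

lemma bounded_left_increments:
  assumes S: "sym_gen_set G S" and S': "sym_gen_set G S'"
    and C: "\<forall>a\<in>carrier G. \<forall>s\<in>S. \<bar>\<phi> (s \<otimes> a) - \<phi> a\<bar> \<le> (C::int)"
  shows "\<exists>C. \<forall>a\<in>carrier G. \<forall>s\<in>S'. \<bar>\<phi> (s \<otimes> a) - \<phi> a\<bar> \<le> C"
proof -
  have SG: "S \<subseteq> carrier G" "S' \<subseteq> carrier G" "finite S'" using S S' by (auto simp: sym_gen_set_def)
  define \<psi> where "\<psi> a = \<phi> (inv a)" for a
  have "\<bar>\<psi> (a \<otimes> s) - \<psi> a\<bar> \<le> C" if "a \<in> carrier G" "s \<in> S" for a s
    using C that S SG by (auto simp: \<psi>_def inv_mult_group subset_iff sym_gen_set_def)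
  then have "\<forall>a\<in>carrier G. \<forall>s\<in>S. \<bar>\<psi> (a \<otimes> s) - \<psi> a\<bar> \<le> C" by blast
  from bounded_increments[OF S this SG(3,2)]
  obtain C' where C': "\<And>a s. a \<in> carrier G \<Longrightarrow> s \<in> S' \<Longrightarrow> \<bar>\<psi> (a \<otimes> s) - \<psi> a\<bar> \<le> C'"
    by blast
  have "\<bar>\<phi> (s \<otimes> a) - \<phi> a\<bar> \<le> C'" if "a \<in> carrier G" "s \<in> S'" for a s
    using C'[of "inv a" "inv s"] that S' SG by (auto simp: \<psi>_def inv_mult_group subset_iff sym_gen_set_def)
  then show ?thesis by blast
qed

text \<open>The state after reading \<open>u \<in> L'\<close> records, for every \<open>w \<in> L\<close> that fellow travels \<open>u\<close>, the
  position of its endpoint relative to that of \<open>u\<close>, its state, and the difference of the values of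
  \<open>\<phi>\<close>. The word of \<open>L\<close> with the same endpoint as \<open>u @ [s]\<close> extends one of these.\<close>

lemma weakly_combable_transfer:
  assumes hyp: "hyperbolic_group G" and S: "sym_gen_set G S" and S': "sym_gen_set G S'"
    and L: "combing G S L" and L': "combing G S' L'" and \<phi>: "combable G S L \<phi>"
  shows "weakly_combable G S' L' \<phi>"
proof -
  define h where "h w = \<phi> (word_eval G w)" for w
  have Lpc: "prefix_closed L" "L \<subseteq> lists S" and L'pc: "prefix_closed L'" "L' \<subseteq> lists S'"
    using L L' by (auto simp: combing_def prefix_closed_regular_def)
  have bij: "bij_betw (word_eval G) L (carrier G)" "bij_betw (word_eval G) L' (carrier G)"
    using L L' by (auto simp: combing_def)
  have "L' \<noteq> {}" using bij_betw_imp_surj_on[OF bij(2)] by auto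
  then have Nil: "[] \<in> L'" using L'pc(1) by (auto simp: prefix_closed_def)
  have Lcl: "word_eval G w \<in> carrier G" if "w \<in> L" for w using bij_betwE[OF bij(1)] that by blast
  have L'cl: "word_eval G w \<in> carrier G" if "w \<in> L'" for w using bij_betwE[OF bij(2)] that by blast
  obtain \<Gamma> c where "parameterizes S \<Gamma> L"
    "\<forall>w\<in>L. \<forall>\<gamma>. path_for \<Gamma> w \<gamma> \<longrightarrow> \<phi> (word_eval G w) = (\<Sum>i=0..length w. c (\<gamma> i))"
    using \<phi> by (auto simp: combable_def weakly_combable_def)
  then obtain st :: "'a list \<Rightarrow> nat" where st: "state_map L st h"
    using parameterizes_state_map[of S \<Gamma> L h c] unfolding h_def by blast
  \<comment> \<open>With the zero function, \<open>st'\<close> only keeps track of which letters may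
    follow within \<open>L'\<close>.\<close>
  obtain \<Gamma>' where "parameterizes S' \<Gamma>' L'" using L' by (auto simp: combing_def prefix_closed_regular_def)
  then obtain st' :: "'a list \<Rightarrow> nat" where st': "state_map L' st' (\<lambda>_. 0)"
    using parameterizes_state_map[of S' \<Gamma>' L' "\<lambda>_. 0" "\<lambda>_. 0"] by auto
  obtain T K where T: "sym_gen_set G T"
    and "\<And>u w. u \<in> lists S' \<Longrightarrow> w \<in> lists S \<Longrightarrow> length u = word_length G S' (word_eval G u) \<Longrightarrow>
      length w = word_length G S (word_eval G w) \<Longrightarrow> word_eval G u = word_eval G w \<Longrightarrow> fellow_travels G T K u w"
    using geodesic_words_fellow_travel[OF hyp S S'] by metis
  then have ft: "fellow_travels G T K u w" if "u \<in> L'" "w \<in> L" "word_eval G u = word_eval G w" for u w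
    using that L L' Lpc(2) L'pc(2) unfolding combing_def by blast
  define B where "B = {g \<in> carrier G. word_length G T g \<le> K}"
  have B: "finite B" "B \<subseteq> carrier G" using finite_word_ball[OF T] by (auto simp: B_def)
  obtain C where C: "\<And>a b. a \<in> carrier G \<Longrightarrow> b \<in> B \<Longrightarrow> \<bar>\<phi> (a \<otimes> b) - \<phi> a\<bar> \<le> C"
    using bounded_increments[OF S _ B] \<phi> unfolding combable_def by metis
  define rel where "rel u w = inv (word_eval G u) \<otimes> word_eval G w" for u w
  define f where "f u = (st' u, (\<lambda>w. (rel u w, st w, h w - h u)) ` {w \<in> L. fellow_travels G T K u w})" for u
  \<comment> \<open>Reason for finiteness: fellow travelling keeps the relative position in the
    finite ball \<open>B\<close>, and across \<open>B\<close> the Lipschitz function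
    \<open>\<phi>\<close> varies by at most \<open>C\<close>.\<close>
  have rel_B: "rel u w \<in> B" and h_C: "h w - h u \<in> {-C..C}"
    if "u \<in> L'" "w \<in> L" "fellow_travels G T K u w" for u w
  proof -
    show r: "rel u w \<in> B"
      using fellow_travels_dist[OF T that(3)] that Lcl L'cl by (simp add: B_def rel_def word_dist_def)
    have "word_eval G w = word_eval G u \<otimes> rel u w"
      using that Lcl L'cl by (simp add: rel_def m_assoc[symmetric])
    then show "h w - h u \<in> {-C..C}" using C[OF L'cl[OF that(1)] r] by (auto simp: h_def)
  qed
  have "f ` L' \<subseteq> st' ` L' \<times> Pow (B \<times> st ` L \<times> {-C..C})"
    using rel_B h_C by (auto simp: f_def)
  moreover have "finite (st' ` L' \<times> Pow (B \<times> st ` L \<times> {-C..C}))"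
    using st st' B by (simp add: state_map_def)
  ultimately have fin: "finite (f ` L')" by (rule finite_subset)
  have L_snoc: "u \<in> L'" "s \<in> carrier G" "word_eval G (u @ [s]) = word_eval G u \<otimes> s" if "u @ [s] \<in> L'" for u s
  proof -
    show u: "u \<in> L'" using L'pc(1) that by (auto simp: prefix_closed_def prefix_def)
    have sub: "set (u @ [s]) \<subseteq> carrier G" using L'pc(2) that lists_carrier[OF S'] by blast
    then show s: "s \<in> carrier G" by simp
    show "word_eval G (u @ [s]) = word_eval G u \<otimes> s"
      using word_eval_append[of u "[s]"] sub by simp
  qed
  have L_append: "w \<in> L" "word_eval G x \<in> carrier G" "word_eval G (w @ x) = word_eval G w \<otimes> word_eval G x"
    if "w @ x \<in> L" for w x
  proof -
    show w: "w \<in> L" using Lpc(1) that by (auto simp: prefix_closed_def prefix_def)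
    have "set (w @ x) \<subseteq> carrier G" using Lpc(2) that lists_carrier[OF S] by blast
    then have sub: "set w \<subseteq> carrier G" "set x \<subseteq> carrier G" by simp_all
    show "word_eval G x \<in> carrier G" "word_eval G (w @ x) = word_eval G w \<otimes> word_eval G x"
      using sub word_eval_closed word_eval_append by auto
  qed
  have rel_extend: "rel (u @ [s]) (w @ x) = inv s \<otimes> rel u w \<otimes> word_eval G x" if "u @ [s] \<in> L'" "w @ x \<in> L" for u s w x
    using L_snoc[OF that(1)] L_append[OF that(2)] Lcl L'cl by (simp add: rel_def inv_mult_group m_assoc)
  \<comment> \<open>Drop the last block \<open>x\<close> of \<open>w\<close>, replace the remaining
    word by one that has the same data relative to \<open>v\<close>, and append \<open>x\<close>
    again. The values of \<open>h\<close> are compared with those at \<open>u\<close> and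
    \<open>v\<close>, since the increments over the letter \<open>s\<close> are not yet known to
    agree.\<close>
  have follow: "\<exists>w'\<in>L. fellow_travels G T K (v @ [s]) w' \<and> rel (u @ [s]) w = rel (v @ [s]) w' \<and>
      st w = st w' \<and> h w - h u = h w' - h v"
    if us: "u @ [s] \<in> L'" and vs: "v @ [s] \<in> L'" and fuv: "f u = f v"
      and w: "w \<in> L" "fellow_travels G T K (u @ [s]) w" for u v s w
  proof -
    obtain w1 x where w1: "w = w1 @ x" "fellow_travels G T K u w1"
      "word_dist G T (word_eval G (u @ [s])) (word_eval G w) \<le> K"
      using w(2) by (rule fellow_travels_snocE)
    have w1L: "w1 \<in> L" using L_append(1) w w1(1) by blast
    then have "(rel u w1, st w1, h w1 - h u) \<in> snd (f u)" using w1 by (auto simp: f_def)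
    then have "(rel u w1, st w1, h w1 - h u) \<in> snd (f v)" using fuv by simp
    then obtain w2 where w2: "w2 \<in> L" "fellow_travels G T K v w2" "rel u w1 = rel v w2" "st w1 = st w2"
      "h w1 - h u = h w2 - h v" by (auto simp: f_def)
    have ext: "w2 @ x \<in> L" "st (w1 @ x) = st (w2 @ x)" "h (w1 @ x) - h w1 = h (w2 @ x) - h w2"
      using state_map_append[OF st Lpc(1) w1L w2(1,4), of x] w w1(1) by auto
    have r: "rel (u @ [s]) w = rel (v @ [s]) (w2 @ x)"
      using rel_extend[OF us, of w1 x] rel_extend[OF vs ext(1)] w w1(1) w2(3) by simp
    then have "word_dist G T (word_eval G (v @ [s])) (word_eval G (w2 @ x)) \<le> K"
      using w1(3) by (simp add: word_dist_def rel_def)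
    then have "fellow_travels G T K (v @ [s]) (w2 @ x)" by (rule fellow_travels.snoc[OF w2(2)])
    then show ?thesis using ext r w2(5) w1(1) by (intro bexI[of _ "w2 @ x"]) auto
  qed
  \<comment> \<open>Apply \<open>follow\<close> to the word of \<open>L\<close> with the same
    endpoint as \<open>u @ [s]\<close>. Its relative position is trivial, so the word obtained for
    \<open>v\<close> ends where \<open>v @ [s]\<close> does.\<close>
  have step: "h (u @ [s]) - h u = h (v @ [s]) - h v"
    if us: "u @ [s] \<in> L'" and vs: "v @ [s] \<in> L'" and fuv: "f u = f v" for u v s
  proof -
    obtain w where w: "w \<in> L" "word_eval G w = word_eval G (u @ [s])"
      using bij_betw_imp_surj_on[OF bij(1)] L'cl[OF us] by (metis imageE)
    obtain w' where w': "w' \<in> L" "rel (u @ [s]) w = rel (v @ [s]) w'" "h w - h u = h w' - h v"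
      using follow[OF us vs fuv w(1) ft[OF us w(1) w(2)[symmetric]]] by blast
    have "inv (word_eval G (v @ [s])) \<otimes> word_eval G w' = \<one>"
      using w' w(2) L'cl[OF us] by (simp add: rel_def)
    then have "word_eval G w' = word_eval G (v @ [s])"
      using L'cl[OF vs] Lcl[OF w'(1)] by (metis inv_closed inv_equality inv_inv)
    then show ?thesis using w'(3) w(2) by (simp add: h_def)
  qed
  \<comment> \<open>Equality of the increments now allows the base points \<open>u\<close> and
    \<open>v\<close> to be replaced by \<open>u @ [s]\<close> and \<open>v @ [s]\<close>. The
    converse inclusion comes from exchanging \<open>u\<close> and \<open>v\<close>.\<close>
  have sub: "snd (f (u @ [s])) \<subseteq> snd (f (v @ [s]))"
    if us: "u @ [s] \<in> L'" and vs: "v @ [s] \<in> L'" and fuv: "f u = f v" for u v s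
  proof
    fix y assume "y \<in> snd (f (u @ [s]))"
    then obtain w where w: "w \<in> L" "fellow_travels G T K (u @ [s]) w" "y = (rel (u @ [s]) w, st w, h w - h (u @ [s]))"
      by (auto simp: f_def)
    obtain w' where w': "w' \<in> L" "fellow_travels G T K (v @ [s]) w'" "rel (u @ [s]) w = rel (v @ [s]) w'"
      "st w = st w'" "h w - h u = h w' - h v"
      using follow[OF us vs fuv w(1,2)] by blast
    have "y = (rel (v @ [s]) w', st w', h w' - h (v @ [s]))" using w(3) w' step[OF us vs fuv] by simp
    then show "y \<in> snd (f (v @ [s]))" using w' by (auto simp: f_def)
  qed
  have "v @ [s] \<in> L' \<and> f (u @ [s]) = f (v @ [s]) \<and> h (u @ [s]) - h u = h (v @ [s]) - h v"
    if "u \<in> L'" "v \<in> L'" "f u = f v" "u @ [s] \<in> L'" for u v s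
  proof -
    have "st' u = st' v" using that(3) by (simp add: f_def)
    from state_map_snoc[OF st' that(1,2) this that(4)]
    have vs: "v @ [s] \<in> L'" "st' (u @ [s]) = st' (v @ [s])" by auto
    have "snd (f (u @ [s])) = snd (f (v @ [s]))"
      using sub[OF that(4) vs(1) that(3)] sub[OF vs(1) that(4) that(3)[symmetric]] by (rule equalityI)
    then have "f (u @ [s]) = f (v @ [s])" using vs(2) by (simp add: f_def)
    then show ?thesis using vs step[OF that(4) vs(1) that(3)] by simp
  qed
  then have "state_map L' f h" unfolding state_map_def using fin by blast
  moreover have "finite S'" using S' by (simp add: sym_gen_set_def)
  ultimately obtain \<Gamma>'' c'' where "parameterizes S' \<Gamma>'' L'"
    "\<forall>w\<in>L'. \<forall>\<gamma>. path_for \<Gamma>'' w \<gamma> \<longrightarrow> h w = (\<Sum>i=0..length w. c'' (\<gamma> i))"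
    using state_map_parameterizes[of L' f h S'] L'pc Nil by blast
  then show ?thesis unfolding weakly_combable_def h_def by blast
qed

section \<open>Independence of the combing\<close>

lemma combable_transfer:
  assumes "hyperbolic_group G" "sym_gen_set G S" "sym_gen_set G S'" "combing G S L" "combing G S' L'"
    and \<phi>: "combable G S L \<phi>"
  shows "combable G S' L' \<phi>"
proof -
  have "finite S'" "S' \<subseteq> carrier G" using assms(3) by (auto simp: sym_gen_set_def)
  then show ?thesis
    using weakly_combable_transfer[OF assms] bounded_increments[OF assms(2), of \<phi> _ S'] \<phi>
    unfolding combable_def by blast
qed

lemma bicombable_transfer:
  assumes "hyperbolic_group G" "sym_gen_set G S" "sym_gen_set G S'" "combing G S L" "combing G S' L'"
    and "bicombable G S L \<phi>"
  shows "bicombable G S' L' \<phi>"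
  using combable_transfer[OF assms(1-5)] bounded_left_increments[OF assms(2,3)] assms(6)
  unfolding bicombable_def by blast

end

theorem lemma3p8:
  fixes G :: "('a, 'b) monoid_scheme"
    and S S' :: "'a set"
    and L L' :: "'a list set"
    and \<phi> :: "'a \<Rightarrow> int"
  assumes "hyperbolic_group G"
    and "sym_gen_set G S"
    and "sym_gen_set G S'"
    and "combing G S L"
    and "combing G S' L'"
  shows "(combable G S L \<phi> \<longleftrightarrow> combable G S' L' \<phi>) \<and>
         (bicombable G S L \<phi> \<longleftrightarrow> bicombable G S' L' \<phi>)"
proof -
  interpret group G using assms(1) by (simp add: hyperbolic_group_def)
  show ?thesis
    \<comment> \<open>The reverse implications are the same transfer with the two generating sets
      and combings exchanged.\<close>
    using combable_transfer[OF assms] combable_transfer[OF assms(1,3,2,5,4)]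
      bicombable_transfer[OF assms] bicombable_transfer[OF assms(1,3,2,5,4)] by blast
qed

end
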